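(* Let $P_0$ be a fixed positive integer. Then there are at most finitely many perfect $2$-codes (with words of length $n>2$) on $q$ symbols, where $q\ge 2$ ranges over integers whose greatest prime factor $P(q)$ satisfies $P(q)\le P_0$.
   Context: Let $F$ be a finite set (alphabet) of cardinality $q\ge 2$, let $n$ be a positive integer, and let $V=F^n$ (the set of words of length $n$). The Hamming distance $d_F(\mathbf{x},\mathbf{y})$ is the number of coordinates in which $\mathbf{x},\mathbf{y}\in V$ differ, and $S(\mathbf{x},e)=\{\mathbf{y}\in V: d_F(\mathbf{x},\mathbf{y})\le e\}$ for a nonnegative integer $e$. A subset $\mathcal{C}\subseteq V$ is a perfect $e$-code on $q$ symbols if for every $\mathbf{y}\in V$ there is a unique $\mathbf{x}\in\mathcal{C}$ with $d_F(\mathbf{x},\mathbf{y})\le e$ (equivalently, the spheres $S(\mathbf{x},e)$, $\mathbf{x}\in\mathcal{C}$, partition $V$). Codes are considered over one fixed alphabet of each size $q$ (e.g. $F=\{1,\dots,q\}$), so "at most finitely many codes" means that only finitely many pairs $(q,n)$ with $n>2$ admit a perfect $2$-code of the given kind. $P(m)$ denotes the greatest prime factor of the integer $m$. *)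

theory Defs
  imports "HOL-Computational_Algebra.Primes"
begin

definition words :: "'a set \<Rightarrow> nat \<Rightarrow> 'a list set" where
  "words F n = {x. set x \<subseteq> F \<and> length x = n}"

(* Used only for words of equal length. *)
definition hamming_dist :: "'a list \<Rightarrow> 'a list \<Rightarrow> nat" where
  "hamming_dist x y = card {i. i < length x \<and> x ! i \<noteq> y ! i}"

definition perfect_code :: "'a set \<Rightarrow> nat \<Rightarrow> nat \<Rightarrow> 'a list set \<Rightarrow> bool" where
  "perfect_code F n e C \<longleftrightarrow>
     C \<subseteq> words F n \<and> (\<forall>y\<in>words F n. \<exists>!x. x \<in> C \<and> hamming_dist x y \<le> e)"

(* Meaningful only for m \<ge> 2, where the set of prime factors is nonempty and finite. *)
definition greatest_prime_factor :: "nat \<Rightarrow> nat" where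
  "greatest_prime_factor m = Max (prime_factors m)"

end

(* A perfect 2-code with n > 2 yields, by Lloyd's theorem, two positive integers x and x + d with
   4 x = q (d^2 - 1) - 2 d + 6, whose prime factors divide 2 q. Suppose that there are infinitely many
   such (q, d). All of q, x, x + d are products of bounded primes, so by pigeonhole on the exponent
   vectors there are two solutions, the second much larger than the first, where the numbers of the
   second are almost exact powers of the numbers of the first. The good rational approximations
   carried by the two solutions are then incompatible by the method of Thue: Pade approximants of a
   binomial function, evaluated at the first solution, are compared with the approximation
   provided by the second. If q is at least a small power of d, the approximation is that
   (x + d) / x is close to 1; if q is smaller, it is that 4 q x is close to the square of q d - 1. *)
theory Submission
  imports Defs "HOL-Analysis.Analysis"
begin

section \<open>Lloyd's theorem for perfect 2-codes\<close>

text \<open>Let \<open>s\<close> and \<open>s'\<close> be the values of \<open>d\<close> in the two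
  solutions. A nonzero combination \<open>Q * U - P * W\<close>, with \<open>P\<close>,
  \<open>Q\<close> from the Pade approximant and \<open>U / W\<close> from the second solution,
  becomes an integer after multiplication by \<open>M\<close>, so it is at least
  \<open>1 / M\<close> in absolute value. Up to factors \<open>C ^ n\<close>, \<open>M\<close> times
  the Pade error is about \<open>(4 / q) ^ n\<close> in the first case. This beats the constants
  only if \<open>q\<close> grows, which large \<open>d\<close> does not force; a small
  \<open>q\<close> therefore needs another function. For the square root the quantity is about
  \<open>q ^ (12 * n) / s ^ (4 * n)\<close>, which is small when \<open>q\<close> is below a small
  power of \<open>s\<close>. The threshold \<open>d = q ^ 8\<close> lies inside the range of both
  arguments. The demand \<open>s' \<ge> s ^ (8 * n)\<close> arises because \<open>M\<close> can be
  about \<open>s ^ (4 * n)\<close> or \<open>s ^ (9 * n / 2)\<close>, while the error of the second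
  approximation is only known to be about \<open>s' powr (-7/8)\<close> or better. Correction
  factors below \<open>s ^ (n / 64)\<close> and \<open>s \<ge> 2 ^ 1000\<close> fit into the
  remaining margin.\<close>

definition line_sum :: "'a set \<Rightarrow> nat \<Rightarrow> ('a list \<Rightarrow> real) \<Rightarrow> 'a list \<Rightarrow> real" where
  "line_sum F i f x = (\<Sum>a\<in>F. f (x[i := a]))"

text \<open>On words of length \<open>n\<close> over \<open>F\<close>, \<open>lines_sum F n\<close>
  is the adjacency operator of the Hamming graph plus \<open>n\<close> times the identity, since
  each of the \<open>n\<close> lines through a word contains that word. The variable
  \<open>k\<close> permits induction on the directions.\<close>

definition lines_sum :: "'a set \<Rightarrow> nat \<Rightarrow> ('a list \<Rightarrow> real) \<Rightarrow> 'a list \<Rightarrow> real" where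
  "lines_sum F k f x = (\<Sum>i<k. line_sum F i f x)"

section \<open>Spectrum of the line-sum operators\<close>

lemma line_sum_idem:
  "line_sum F i (line_sum F i f) x = real (card F) * line_sum F i f x"
  by (simp add: line_sum_def)

lemma line_sum_commute:
  "line_sum F i (line_sum F j f) x = line_sum F j (line_sum F i f) x"
proof (cases "i = j")
  case False
  then show ?thesis
    unfolding line_sum_def
    by (subst sum.swap) (simp add: list_update_swap)
qed simp

lemma lines_sum_line_sum:
  "lines_sum F k (line_sum F j f) x = line_sum F j (lines_sum F k f) x"
proof -
  have "lines_sum F k (line_sum F j f) x = (\<Sum>i<k. line_sum F j (line_sum F i f) x)"
    by (simp add: lines_sum_def line_sum_commute)
  also have "\<dots> = line_sum F j (lines_sum F k f) x"
    unfolding lines_sum_def line_sum_def by (subst sum.swap) simp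
  finally show ?thesis .
qed

lemma lines_sum_diff:
  "lines_sum F k (\<lambda>x. f x - c * g x) x = lines_sum F k f x - c * lines_sum F k g x"
  by (simp add: lines_sum_def line_sum_def sum_subtractf sum_distrib_left)

lemma lines_sum_const: "lines_sum F k (\<lambda>x. c) x = real k * real (card F) * c"
  by (simp add: lines_sum_def line_sum_def)

lemma words_update: "x \<in> words F n \<Longrightarrow> a \<in> F \<Longrightarrow> x[i := a] \<in> words F n"
  using set_update_subset_insert[of x i a] by (auto simp: words_def)

lemma line_sum_cong:
  "(\<And>y. y \<in> words F n \<Longrightarrow> f y
      = g y) \<Longrightarrow> x \<in> words F n \<Longrightarrow> line_sum F i f x = line_sum F i g x"
  by (simp add: line_sum_def words_update)

text \<open>If \<open>lines_sum F (Suc k) h = l * h\<close>, then \<open>line_sum F k h\<close> either vanishes, or is an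
  eigenfunction of \<open>lines_sum F k\<close> for \<open>l - card F\<close>, because \<open>line_sum F k\<close> squares to
  \<open>card F\<close> times itself.\<close>

lemma lines_sum_eigenvalue:
  assumes "\<And>x. x \<in> words F n \<Longrightarrow> lines_sum F k h x = l * h x"
    and "x \<in> words F n" "h x \<noteq> 0"
  shows "\<exists>j\<le>k. l = real (card F) * real j"
  using assms
proof (induction k arbitrary: l h x)
  case 0
  from 0(1)[OF 0(2)] 0(3) show ?case by (simp add: lines_sum_def)
next
  case (Suc k)
  define g where "g = line_sum F k h"
  show ?case
  proof (cases "\<exists>y\<in>words F n. g y \<noteq> 0")
    case True
    then obtain y where y: "y \<in> words F n" "g y \<noteq> 0" by blast
    have "lines_sum F k g z = (l - card F) * g z" if z: "z \<in> words F n" for z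
    proof -
      have "lines_sum F k g z = line_sum F k (lines_sum F k h) z"
        unfolding g_def by (rule lines_sum_line_sum)
      also have "\<dots> = line_sum F k (\<lambda>x. l * h x - line_sum F k h x) z"
        using Suc.prems(1) by (intro line_sum_cong[OF _ z]) (force simp: lines_sum_def)
      also have "\<dots> = l * g z - line_sum F k (line_sum F k h) z"
        by (simp add: line_sum_def g_def sum_subtractf sum_distrib_left)
      also have "\<dots> = (l - card F) * g z"
        by (simp add: line_sum_idem g_def algebra_simps)
      finally show ?thesis .
    qed
    from Suc.IH[OF this y] obtain j where "j \<le> k" "l - real (card F) = real (card F) * real j"
      by blast
    then show ?thesis
      by (intro exI[of _ "Suc j"]) (simp add: algebra_simps)
  next
    case False
    have "lines_sum F k h z = l * h z" if "z \<in> words F n" for z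
      using Suc.prems(1)[OF that] False that by (auto simp: lines_sum_def g_def)
    from Suc.IH[OF this Suc.prems(2,3)] show ?thesis by (auto intro: le_SucI)
  qed
qed

lemma finite_words: "finite F \<Longrightarrow> finite (words F n)"
  unfolding words_def by (rule finite_lists_length_eq)

lemma card_words: "finite F \<Longrightarrow> card (words F n) = card F ^ n"
  unfolding words_def by (rule card_lists_length_eq)

lemma sum_line_sum:
  assumes "i < n"
  shows "(\<Sum>x\<in>words F n. line_sum F i f x) = real (card F) * (\<Sum>x\<in>words F n. f x)"
proof -
  have "(\<Sum>x\<in>words F n. line_sum F i f x) = (\<Sum>(x,a)\<in>words F n \<times> F. f (x[i := a]))"
    by (simp add: line_sum_def sum.cartesian_product)
  also have "\<dots> = (\<Sum>(x,a)\<in>words F n \<times> F. f x)"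
    \<comment> \<open>Exchanging \<open>x ! i\<close> with \<open>a\<close> is an involution of
      \<open>words F n \<times> F\<close>.\<close>
    by (rule sum.reindex_bij_witness
        [where i = "\<lambda>(x,a). (x[i := a], x ! i)" and j = "\<lambda>(x,a). (x[i := a], x ! i)"])
      (use assms in \<open>auto simp: words_update, auto simp: words_def\<close>)
  also have "\<dots> = real (card F) * (\<Sum>x\<in>words F n. f x)"
    by (simp add: sum.cartesian_product[symmetric] sum_distrib_left)
  finally show ?thesis .
qed

lemma sum_lines_sum:
  "(\<Sum>x\<in>words F n. lines_sum F n f x) = real n * real (card F) * (\<Sum>x\<in>words F n. f x)"
  unfolding lines_sum_def by (subst sum.swap) (simp add: sum_line_sum)

section \<open>Words, their nearest codewords, and the Lloyd zeros\<close>

definition diff_set :: "'a list \<Rightarrow> 'a list \<Rightarrow> nat set" where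
  "diff_set x y = {i. i < length x \<and> x ! i \<noteq> y ! i}"

lemma finite_diff_set: "finite (diff_set x y)"
  by (simp add: diff_set_def)

lemma hamming_dist_diff_set: "hamming_dist x y = card (diff_set x y)"
  by (simp add: hamming_dist_def diff_set_def)

lemma diff_set_commute: "length x = length y \<Longrightarrow> diff_set x y = diff_set y x"
  by (auto simp: diff_set_def)

lemma update_eq_iff:
  assumes "length x = length c" "i < length x"
  shows "x[i := a] = c \<longleftrightarrow> a = c ! i \<and> diff_set x c \<subseteq> {i}"
  using assms by (auto simp: list_eq_iff_nth_eq nth_list_update diff_set_def)

lemma update2_eq_iff:
  assumes "length x = length c" "i < length x" "j < length x" "i \<noteq> j"
  shows "x[i := a, j := b] = c \<longleftrightarrow> a = c ! i \<and> b = c ! j \<and> diff_set x c \<subseteq> {i, j}"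
  using assms by (auto simp: list_eq_iff_nth_eq nth_list_update diff_set_def)

locale perfect_2_code =
  fixes F :: "'a set" and n :: nat and C :: "'a list set"
  assumes finite_F: "finite F" and card_F: "card F \<ge> 2" and n_gt: "n > 2"
    and perfect: "perfect_code F n 2 C"
begin

abbreviation "V \<equiv> words F n"
abbreviation "q \<equiv> real (card F)"
abbreviation "S \<equiv> lines_sum F n"
definition "ind x = (if x \<in> C then 1 else 0 :: real)"

lemma C_subset: "C \<subseteq> V"
  using perfect by (simp add: perfect_code_def)

definition "near y = (THE x. x \<in> C \<and> hamming_dist x y \<le> 2)"

lemma near: "y \<in> V \<Longrightarrow> near y \<in> C" "y \<in> V \<Longrightarrow> card (diff_set y (near y)) \<le> 2"
  and near_unique: "y \<in> V \<Longrightarrow> c \<in> C \<Longrightarrow> card (diff_set y c)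
      \<le> 2 \<Longrightarrow> c = near y"
proof -
  have sym: "hamming_dist x y = card (diff_set y x)" if "x \<in> C" "y \<in> V" for x y
    using that C_subset diff_set_commute[of x y]
    by (auto simp: hamming_dist_diff_set words_def)
  have ex1: "\<exists>!x. x \<in> C \<and> hamming_dist x y \<le> 2" if "y \<in> V" for y
    using perfect that by (simp add: perfect_code_def)
  have th: "near y \<in> C \<and> hamming_dist (near y) y \<le> 2" if "y \<in> V" for y
    using theI'[OF ex1[OF that]] unfolding near_def .
  show "y \<in> V \<Longrightarrow> near y \<in> C" "y \<in> V \<Longrightarrow> card (diff_set y (near y)) \<le> 2"
    using th sym by (blast, metis)
  show "y \<in> V \<Longrightarrow> c \<in> C \<Longrightarrow> card (diff_set y c) \<le> 2 \<Longrightarrow> c = near y"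
    using the1_equality[OF ex1] sym unfolding near_def by metis
qed

lemma ind_iff: 
  assumes "x \<in> V" shows "ind x = (if diff_set x (near x) = {} then 1 else 0)"
proof (cases "x \<in> C")
  case True
  have "diff_set x x = {}" by (simp add: diff_set_def)
  moreover have "near x = x" using near_unique[OF assms True] calculation by simp
  ultimately show ?thesis using True by (simp add: ind_def)
next
  case False
  have "diff_set x (near x) \<noteq> {}"
  proof
    assume "diff_set x (near x) = {}"
    then have "x = near x" using assms near(1)[OF assms] C_subset
      by (auto simp: diff_set_def list_eq_iff_nth_eq words_def)
    with near(1)[OF assms] False show False by simp
  qed
  with False show ?thesis by (simp add: ind_def)
qed

lemma near_nth: "x \<in> V \<Longrightarrow> i < n \<Longrightarrow> near x ! i \<in> F"
  using near(1)[of x] C_subset nth_mem[of i "near x"] by (fastforce simp: words_def)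

lemma length_near: "x \<in> V \<Longrightarrow> length x = n \<and> length (near x) = n"
  using near(1)[of x] C_subset by (auto simp: words_def)

text \<open>A word on the line differs from \<open>x\<close> in at most one place, so if it lies in
  the code it is \<open>near x\<close>; the line meets the code in at most this word.\<close>

lemma line_sum_ind:
  assumes x: "x \<in> V" and i: "i < n"
  shows "line_sum F i ind x = (if diff_set x (near x) \<subseteq> {i} then 1 else 0)"
proof -
  have "ind (x[i := a]) = (if a = near x ! i then if diff_set x (near x) \<subseteq> {i} then 1 else 0 else 0)"
    if a: "a \<in> F" for a
  proof -
    have "x[i := a] = near x" if c: "x[i := a] \<in> C"
    proof (rule near_unique[OF x c])
      have "diff_set x (x[i := a]) \<subseteq> {i}"
        by (auto simp: diff_set_def) (metis nth_list_update_neq)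
      then have "card (diff_set x (x[i := a])) \<le> card {i}" by (intro card_mono) auto
      then show "card (diff_set x (x[i := a])) \<le> 2" by simp
    qed
    then have "x[i := a] \<in> C \<longleftrightarrow> x[i := a] = near x" using near(1)[OF x] by auto
    then show ?thesis using update_eq_iff[of x "near x" i a] length_near[OF x] i
      by (auto simp: ind_def)
  qed
  then have "line_sum F i ind x = (\<Sum>a\<in>F. if a
      = near x ! i then if diff_set x (near x) \<subseteq> {i} then 1 else 0 else 0)"
    by (simp add: line_sum_def)
  then show ?thesis using near_nth[OF x i] finite_F by (simp add: sum.delta)
qed

text \<open>Two altered letters stay within distance 2, the full radius of the code, so
  \<open>near x\<close> is again the only codeword that can occur.\<close>

lemma line_sum2_ind:
  assumes x: "x \<in> V" and i: "i < n" and j: "j < n" and ij: "i \<noteq> j"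
  shows "line_sum F i (line_sum F j ind) x = (if diff_set x (near x) \<subseteq> {i, j} then 1 else 0)"
proof -
  have "ind (x[i := a, j := b]) = (if b = near x ! j then if a = near x ! i then 
      if diff_set x (near x) \<subseteq> {i,j} then 1 else 0 else 0 else 0)"
    if a: "a \<in> F" and b: "b \<in> F" for a b
  proof -
    have "x[i := a, j := b] = near x" if c: "x[i := a, j := b] \<in> C"
    proof (rule near_unique[OF x c])
      have "diff_set x (x[i := a, j := b]) \<subseteq> {i, j}"
        by (auto simp: diff_set_def) (metis nth_list_update_neq)
      then have "card (diff_set x (x[i := a, j := b])) \<le> card {i, j}" by (intro card_mono) auto
      then show "card (diff_set x (x[i := a, j := b])) \<le> 2" using ij by simp
    qed
    then have "x[i := a, j := b] \<in> C \<longleftrightarrow> x[i := a, j := b] = near x" using near(1)[OF x] by auto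
    then show ?thesis using update2_eq_iff[of x "near x" i j a b] length_near[OF x] i j ij
      by (auto simp: ind_def)
  qed
  then have "line_sum F i (line_sum F j ind) x = (\<Sum>a\<in>F. \<Sum>b\<in>F. if b = near x ! j then if a
      = near x ! i then 
      if diff_set x (near x) \<subseteq> {i,j} then 1 else 0 else 0 else 0)"
    by (simp add: line_sum_def)
  then show ?thesis using near_nth[OF x i] near_nth[OF x j] finite_F by (simp add: sum.delta)
qed

lemma S_ind:
  assumes x: "x \<in> V"
  shows "S ind x = real (card {i. i < n \<and> diff_set x (near x) \<subseteq> {i}})"
proof -
  have "S ind x = (\<Sum>i<n. if diff_set x (near x) \<subseteq> {i} then 1 else 0)"
    by (simp add: lines_sum_def line_sum_ind x)
  also have "\<dots> = real (card {i\<in>{..<n}. diff_set x (near x) \<subseteq> {i}})"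
    by (simp add: sum.If_cases Int_def)
  finally show ?thesis by simp
qed

text \<open>The diagonal terms of the double sum collapse by \<open>line_sum_idem\<close>. What
  remains counts ordered pairs of distinct directions that cover the errors of
  \<open>x\<close>.\<close>

lemma SS_ind:
  assumes x: "x \<in> V"
  shows "S (S ind) x - q * S ind x = (\<Sum>i<n. real (card {j. j < n \<and> j \<noteq> i \<and> diff_set x (near x) \<subseteq> {i,j}}))"
proof -
  let ?D = "diff_set x (near x)"
  have "S (S ind) x = (\<Sum>i<n. \<Sum>j<n. line_sum F i (line_sum F j ind) x)"
    unfolding lines_sum_def line_sum_def by (intro sum.cong refl) (subst sum.swap, simp)
  also have "\<dots> = (\<Sum>i<n. q * line_sum F i ind x + (\<Sum>j\<in>{..<n}-{i}. if ?D \<subseteq> {i,j} then 1 else 0))"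
  proof (intro sum.cong refl)
    fix i assume i: "i \<in> {..<n}"
    then have "(\<Sum>j<n. line_sum F i (line_sum F j ind) x) = line_sum F i (line_sum F i ind) x
        + (\<Sum>j\<in>{..<n}-{i}. line_sum F i (line_sum F j ind) x)"
      by (intro sum.remove) auto
    also have "(\<Sum>j\<in>{..<n}-{i}. line_sum F i (line_sum F j ind) x)
       = (\<Sum>j\<in>{..<n}-{i}. if ?D \<subseteq> {i,j} then 1 else 0)"
      using i x by (intro sum.cong refl line_sum2_ind) auto
    finally show "(\<Sum>j<n. line_sum F i (line_sum F j ind) x)
        = q * line_sum F i ind x + (\<Sum>j\<in>{..<n}-{i}. if ?D \<subseteq> {i,j} then 1 else 0)"
      by (simp add: line_sum_idem)
  qed
  also have "\<dots> = q * S ind x + (\<Sum>i<n. \<Sum>j\<in>{..<n}-{i}. if ?D \<subseteq> {i,j} then 1 else 0)"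
    by (simp add: sum.distrib lines_sum_def sum_distrib_left)
  also have "(\<Sum>i<n. \<Sum>j\<in>{..<n}-{i}. if ?D \<subseteq> {i,j} then 1 else 0) =
      (\<Sum>i<n. real (card {j. j < n \<and> j \<noteq> i \<and> ?D \<subseteq> {i,j}}))"
    by (intro sum.cong refl) (auto simp: sum.If_cases Int_def intro!: arg_cong[where f = card])
  finally show ?thesis by simp
qed

lemma diff_set_cases:
  assumes x: "x \<in> V"
  obtains "diff_set x (near x) = {}" 
  | u where "u < n" "diff_set x (near x) = {u}"
  | u v where "u < n" "v < n" "u \<noteq> v" "diff_set x (near x) = {u, v}"
proof -
  let ?D = "diff_set x (near x)"
  have D: "?D \<subseteq> {..<n}" using length_near[OF x] by (auto simp: diff_set_def)
  have "card ?D \<le> 2" by (rule near(2)[OF x])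
  then consider "card ?D = 0" | "card ?D = 1" | "card ?D = 2" by linarith
  then show ?thesis
  proof cases
    case 1
    then show ?thesis using that(1) by (simp add: finite_diff_set)
  next
    case 2
    then show ?thesis using that(2) D by (auto simp: card_1_singleton_iff)
  next
    case 3
    then show ?thesis using that(3) D by (auto simp: card_2_iff)
  qed
qed

lemma S_ind_eq:
  assumes x: "x \<in> V"
  shows "diff_set x (near x) = {} \<Longrightarrow> S ind x = n"
   and "diff_set x (near x) = {u} \<Longrightarrow> S ind x = 1"
   and "diff_set x (near x) = {u,v} \<Longrightarrow> u \<noteq> v \<Longrightarrow> S ind x = 0"
proof -
  have D: "diff_set x (near x) \<subseteq> {..<n}" using length_near[OF x] by (auto simp: diff_set_def)
  show "diff_set x (near x) = {} \<Longrightarrow> S ind x = n" using S_ind[OF x] by simp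
  show "diff_set x (near x) = {u} \<Longrightarrow> S ind x = 1"
  proof -
    assume h: "diff_set x (near x) = {u}"
    then have "{i. i < n \<and> diff_set x (near x) \<subseteq> {i}} = {u}" using D by auto
    then show ?thesis using S_ind[OF x] by simp
  qed
  show "diff_set x (near x) = {u,v} \<Longrightarrow> u \<noteq> v \<Longrightarrow> S ind x = 0"
    using S_ind[OF x] by auto
qed

text \<open>At distance 0, 1, 2 from the code, \<open>S (S ind) - q * S ind\<close> takes the values
  \<open>n * (n - 1)\<close>, \<open>2 * (n - 1)\<close>, 2, while \<open>S ind\<close> takes
  \<open>n\<close>, 1, 0 and \<open>ind\<close> takes 1, 0, 0. The coefficients are those that make
  the combination constant.\<close>

lemma key_equation:
  assumes x: "x \<in> V"
  shows "S (S ind) x - (q + 2 * (real n - 2)) * S ind x + (real n - 1) * (real n - 2) * ind x = 2"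
proof -
  let ?D = "diff_set x (near x)"
  note i = ind_iff[OF x] note s = S_ind_eq[OF x] 
  note ss = SS_ind[OF x]
  from x show ?thesis
  proof (cases rule: diff_set_cases)
    case 1
    have "{j. j < n \<and> j \<noteq> i} = {..<n} - {i}" for i by auto
    then have "(\<Sum>i<n. real (card {j. j < n \<and> j \<noteq> i \<and> ?D \<subseteq> {i,j}})) = real n * (real n - 1)"
      using 1 n_gt by (simp add: of_nat_diff)
    then show ?thesis using ss s(1)[OF 1] i 1 by (simp add: algebra_simps)
  next
    case (2 u)
    have "card {j. j < n \<and> j \<noteq> i \<and> ?D \<subseteq> {i,j}} = (if i = u then n - 1 else 1)" if "i < n" for i
    proof (cases "i = u")
      case True
      have "{j. j < n \<and> j \<noteq> i} = {..<n} - {i}" by auto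
      then show ?thesis using True 2 that by simp
    next
      case False
      have "{j. j < n \<and> j \<noteq> i \<and> ?D \<subseteq> {i,j}} = {u}" using 2 False by auto
      then show ?thesis using False by simp
    qed
    then have "(\<Sum>i<n. real (card {j. j < n \<and> j \<noteq> i \<and> ?D \<subseteq> {i,j}}))
        = (\<Sum>i<n. real (if i = u then n - 1 else 1))"
      by (intro sum.cong) auto
    also have "\<dots> = (\<Sum>i<n. 1 + (if i = u then real n - 2 else 0))"
      using n_gt by (intro sum.cong) (auto simp: of_nat_diff)
    also have "\<dots> = real n + (real n - 2)"
      using 2 by (simp add: sum.distrib)
    finally show ?thesis using ss s(2)[OF 2(2)] i 2 by (simp add: algebra_simps)
  next
    case (3 u v)
    have "real (card {j. j < n \<and> j \<noteq> i \<and> ?D \<subseteq> {i,j}}) = (if i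
        = u then 1 else 0) + (if i = v then 1 else 0)" for i
    proof -
      have "{j. j < n \<and> j \<noteq> i \<and> ?D \<subseteq> {i,j}} = (if i = u then {v} else if i = v then {u} else {})"
        using 3 by auto
      then show ?thesis using 3 by simp
    qed
    then have "(\<Sum>i<n. real (card {j. j < n \<and> j \<noteq> i \<and> ?D \<subseteq> {i,j}})) = 2"
      using 3 by (simp add: sum.distrib)
    then show ?thesis using ss s(3)[OF 3(4,3)] i 3 by (simp add: algebra_simps)
  qed
qed

text \<open>\<open>B\<close> is twice the size of a ball of radius 2.\<close>

definition "B = q^2 * n * (real n - 1) - 2 * n * (real n - 2) * q + (real n - 1) * (real n - 2)"

text \<open>Summing \<open>key_equation\<close> over \<open>V\<close> turns each \<open>S\<close>
  into the factor \<open>n * q\<close>, so \<open>B\<close> is the quadratic of that equation at the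
  eigenvalue of the constants. The result is the sphere-packing equality.\<close>

lemma B_card: "B * card C = 2 * q ^ n"
proof -
  have fin: "finite V" by (rule finite_words[OF finite_F])
  have "(\<Sum>x\<in>V. ind x) = (\<Sum>x\<in>C. 1)"
    using C_subset fin by (intro sum.mono_neutral_cong_right) (auto simp: ind_def)
  then have ind: "(\<Sum>x\<in>V. ind x) = real (card C)" by simp
  have "(\<Sum>x\<in>V. S (S ind) x - (q + 2 * (real n - 2)) * S ind x + (real n - 1) * (real n - 2) * ind x)
      = (\<Sum>x\<in>V. 2)"
    using key_equation by (intro sum.cong) auto
  then have "(\<Sum>x\<in>V. S (S ind) x) - (q + 2 * (real n - 2)) * (\<Sum>x\<in>V. S ind x) + (real n - 1) * (real n - 2) * (\<Sum>x\<in>V. ind x) = 2 * card V"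
    by (simp add: sum.distrib sum_subtractf sum_distrib_left)
  then show ?thesis
    unfolding sum_lines_sum ind
    by (simp add: card_words[OF finite_F] B_def algebra_simps power2_eq_square)
qed

text \<open>One or two letters of a codeword are altered; by \<open>near_unique\<close> that
  codeword remains the nearest one, so the distances from the code are exactly 1 and 2.\<close>

lemma far_words:
  obtains x1 x2 where "x1 \<in> V" "x2 \<in> V" "ind x1 = 0" "ind x2 = 0" "S ind x1 = 1" "S ind x2 = 0"
proof -
  have "\<exists>a b. a \<in> F \<and> b \<in> F \<and> a \<noteq> b"
    using card_F finite_F by (metis card_le_Suc0_iff_eq not_less_eq_eq numeral_2_eq_2)
  then obtain a b where ab: "a \<in> F" "b \<in> F" "a \<noteq> b" by blast
  define oth where "oth t = (if t = a then b else a)" for t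
  have oth: "oth t \<in> F" "oth t \<noteq> t" for t using ab by (auto simp: oth_def)
  have "replicate n a \<in> V" using ab by (auto simp: words_def)
  then obtain c where c: "c \<in> C" using near(1) by blast
  then have cV: "c \<in> V" using C_subset by blast
  then have len: "length c = n" by (simp add: words_def)
  define x1 where "x1 = c[0 := oth (c ! 0)]"
  define x2 where "x2 = x1[1 := oth (c ! 1)]"
  have V: "x1 \<in> V" "x2 \<in> V" unfolding x2_def x1_def using cV oth by (auto intro!: words_update)
  have d1: "diff_set x1 c = {0}" using len n_gt oth
    by (auto simp: diff_set_def x1_def nth_list_update)
  have d2: "diff_set x2 c = {0, 1}" using len n_gt oth
    by (auto simp: diff_set_def x1_def x2_def nth_list_update split: if_splits)
  have n1: "near x1 = c" using near_unique[OF V(1) c] d1 by simp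
  have n2: "near x2 = c" using near_unique[OF V(2) c] d2 by simp
  show ?thesis
  proof (rule that[OF V])
    show "ind x1 = 0" "ind x2 = 0" using ind_iff[OF V(1)] ind_iff[OF V(2)] n1 n2 d1 d2 by auto
    show "S ind x1 = 1" using S_ind_eq(2)[OF V(1)] n1 d1 by simp
    show "S ind x2 = 0" using S_ind_eq(3)[OF V(2)] n2 d2 by simp
  qed
qed

lemma B_pos: "B > 0"
proof -
  have "B * card C > 0" using B_card card_F by simp
  then show ?thesis by (simp add: zero_less_mult_iff)
qed

text \<open>This is Lloyd's theorem for \<open>e = 2\<close>, in the variable \<open>l
    = q * (n - x)\<close>. By \<open>key_equation\<close>,
  the quadratic polynomial with roots \<open>l1\<close> and \<open>l2\<close> annihilates \<open>g
      = ind - 2 / B\<close>. The words at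
  distance 1 and 2 from the code show that \<open>g\<close> is not an eigenfunction, so both roots are
  eigenvalues.\<close>

lemma lloyd_root:
  assumes sum: "l1 + l2 = q + 2 * (real n - 2)" and prod: "l1 * l2 = (real n - 1) * (real n - 2)"
  shows "\<exists>j\<le>n. l1 = q * real j"
proof -
  \<comment> \<open>On constants the quadratic in \<open>S\<close> acts as multiplication by
    \<open>B\<close>, so subtracting \<open>2 / B\<close> removes the right-hand side 2 of
    \<open>key_equation\<close>.\<close>
  define g where "g x = ind x - 2 / B * 1" for x
  define h where "h x = S g x - l2 * g x" for x
  have Sg: "S g = (\<lambda>x. S ind x - 2 / B * (n * q))"
    unfolding g_def by (rule ext) (subst lines_sum_diff, simp add: lines_sum_const)
  have SSg: "S (S g) x = S (S ind) x - 2 / B * (n * q * (n * q))" for x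
    unfolding Sg using lines_sum_diff[of F n "S ind" "2/B" "\<lambda>_. n * q" x]
    by (simp add: lines_sum_const)
  have eq: "S (S g) x - (l1 + l2) * S g x + l1 * l2 * g x = 0" if "x \<in> V" for x
  proof -
    define t where "t = 2 / B"
    have t: "t * B = 2" using B_pos by (simp add: t_def)
    have "S (S g) x - (l1 + l2) * S g x + l1 * l2 * g x =
       (S (S ind) x - (q + 2 * (real n - 2)) * S ind x + (real n - 1) * (real n - 2) * ind x)
       - t * B"
      unfolding SSg unfolding Sg g_def sum prod unfolding t_def[symmetric] unfolding B_def
      by (simp add: algebra_simps power2_eq_square)
    also have "\<dots> = 0" using key_equation[OF that] t by simp
    finally show ?thesis .
  qed
  obtain x1 x2 where x: "x1 \<in> V" "x2 \<in> V" "ind x1 = 0" "ind x2 = 0" "S ind x1 = 1" "S ind x2 = 0"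
    by (rule far_words)
  have "h x1 - h x2 = 1" unfolding h_def Sg g_def using x by simp
  then have "h x1 \<noteq> 0 \<or> h x2 \<noteq> 0" by auto
  then obtain x where hx: "x \<in> V" "h x \<noteq> 0" using x by blast
  \<comment> \<open>\<open>h\<close> is the image of \<open>g\<close> under \<open>S - l2\<close>,
    so the other factor \<open>S - l1\<close> of the quadratic annihilates it.\<close>
  have "S h y = l1 * h y" if "y \<in> V" for y
  proof -
    have "S h y = S (S g) y - l2 * S g y" unfolding h_def by (rule lines_sum_diff)
    then show ?thesis using eq[OF that] by (simp add: h_def algebra_simps)
  qed
  from lines_sum_eigenvalue[OF this hx] show ?thesis .
qed

text \<open>\<open>x\<close> and \<open>y\<close> are the Lloyd zeros \<open>n - l / q\<close>. The
  discriminant determines \<open>n\<close> from \<open>q\<close> and \<open>d\<close>; eliminating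
  \<open>n\<close> with the sum of the roots relates \<open>x\<close>, \<open>y\<close>,
  \<open>q\<close>, \<open>d\<close>; the product of the roots and the sphere-packing equality
  restrict the primes.\<close>

lemma parameters:
  obtains x y d :: nat
  where "d \<ge> 2" "x > 0" "y = x + d" "2 * (x + y) + card F = 6 + card F * d\<^sup>2"
    "card F \<le> d\<^sup>2" "(card F)\<^sup>2 * d\<^sup>2 = (card F)\<^sup>2 + 4 * (card F - 1) * (n - 2)"
    "\<And>p. prime p \<Longrightarrow> p dvd x * y \<Longrightarrow> p dvd 2 * card F"
proof -
  define r where "r = sqrt (q\<^sup>2 + 4 * (q - 1) * (real n - 2))"
  have q2: "q \<ge> 2" and n3: "real n > 2" using card_F n_gt by auto
  have r2: "r\<^sup>2 = q\<^sup>2 + 4 * (q - 1) * (real n - 2)"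
    unfolding r_def using q2 n3 by (intro real_sqrt_pow2 add_nonneg_nonneg mult_nonneg_nonneg) auto
  have "4 * (q - 1) * (real n - 2) > 0" using q2 n3 by simp
  then have "r > q" unfolding r_def by (intro real_less_rsqrt) simp
  define l1 where "l1 = (q + 2 * (real n - 2) - r) / 2"
  define l2 where "l2 = (q + 2 * (real n - 2) + r) / 2"
  have l: "l1 + l2 = q + 2 * (real n - 2)" by (simp add: l1_def l2_def field_simps)
  have "4 * (l1 * l2) = (q + 2 * (real n - 2))\<^sup>2 - r\<^sup>2"
    by (simp add: l1_def l2_def field_simps power2_eq_square)
  also have "\<dots> = 4 * ((real n - 1) * (real n - 2))"
    unfolding r2 by (simp add: algebra_simps power2_eq_square)
  finally have l': "l1 * l2 = (real n - 1) * (real n - 2)" by simp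
  from lloyd_root[OF l l'] obtain j1 where j1: "j1 \<le> n" "l1 = q * real j1" by blast
  from lloyd_root[of l2 l1] l l' obtain j2 where j2: "j2 \<le> n" "l2 = q * real j2"
    by (auto simp: add.commute mult.commute)
  have r: "r = q * (real j2 - real j1)" using j1(2) j2(2) by (simp add: l1_def l2_def algebra_simps)
  have "q * (real j2 - real j1 - 1) > 0" using \<open>r > q\<close> r by (simp add: algebra_simps)
  then have jj: "j1 + 1 < j2" using q2 by (simp add: zero_less_mult_iff)
  define x y d where "x = n - j2" and "y = n - j1" and "d = j2 - j1"
  have re: "real x = real n - real j2" "real y = real n - real j1" "real d = real j2 - real j1"
    using jj j1 j2 by (auto simp: x_def y_def d_def)
  have d2: "d \<ge> 2" using jj by (simp add: d_def)
  have qd: "q\<^sup>2 * (real d)\<^sup>2 = q\<^sup>2 + 4 * (q - 1) * (real n - 2)"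
    using r2 unfolding r re(3) by (simp add: power_mult_distrib)
  \<comment> \<open>\<open>B\<close> is the quadratic with roots \<open>l1\<close>,
    \<open>l2\<close> at \<open>n * q\<close>, hence the product of
    \<open>n * q - l1 = q * y\<close> and \<open>n * q - l2 = q * x\<close>.\<close>
  have "real x * real y * q\<^sup>2 = real n * real n * q\<^sup>2 - real n * q * (q * real j1 + q * real j2) + (q * real j1) * (q * real j2)"
    unfolding re by (simp add: algebra_simps power2_eq_square)
  also have "\<dots> = B" unfolding j1(2)[symmetric] j2(2)[symmetric] l l' B_def
    by (simp add: algebra_simps power2_eq_square)
  finally have xyB: "real x * real y * q\<^sup>2 = B" .
  have xpos: "x > 0" using xyB B_pos by (cases "x = 0") auto
  have "real (x * y * (card F)\<^sup>2 * card C) = real (2 * card F ^ n)"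
    using xyB B_card by simp
  then have xyC: "x * y * (card F)\<^sup>2 * card C = 2 * card F ^ n"
    unfolding of_nat_eq_iff .
  have prime: "p dvd 2 * card F" if "prime p" "p dvd x * y" for p
  proof -
    have "p dvd 2 * card F ^ n" unfolding xyC[symmetric] using that(2) by simp
    then show ?thesis using that(1) prime_dvd_power[of p "card F" n] by (auto simp: prime_dvd_mult_iff)
  qed
  have "q * (2 * (real x + real y) + q) = q * (6 + q * (real d)\<^sup>2)"
  proof -
    have "q * (2 * (real x + real y) + q) = 4 * real n * q - 2 * (q * real j1 + q * real j2) + q\<^sup>2"
      unfolding re by (simp add: algebra_simps power2_eq_square)
    also have "\<dots> = 6 * q + (q\<^sup>2 + 4 * (q - 1) * (real n - 2))"
      unfolding j1(2)[symmetric] j2(2)[symmetric] l by (simp add: algebra_simps)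
    also have "\<dots> = q * (6 + q * (real d)\<^sup>2)"
      unfolding qd[symmetric] by (simp add: algebra_simps power2_eq_square)
    finally show ?thesis .
  qed
  then have "2 * (real x + real y) + q = 6 + q * (real d)\<^sup>2" using q2 by simp
  then have "real (2 * (x + y) + card F) = real (6 + card F * d\<^sup>2)" by simp
  then have e1: "2 * (x + y) + card F = 6 + card F * d\<^sup>2" unfolding of_nat_eq_iff .
  have "real ((card F)\<^sup>2 * d\<^sup>2) = real ((card F)\<^sup>2 + 4 * (card F - 1) * (n - 2))"
    using qd card_F n_gt by (simp add: of_nat_diff)
  then have e2: "(card F)\<^sup>2 * d\<^sup>2 = (card F)\<^sup>2 + 4 * (card F - 1) * (n - 2)"
    unfolding of_nat_eq_iff .
  \<comment> \<open>\<open>card F - 1\<close> is coprime to \<open>(card F)\<^sup>2\<close>, so the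
    discriminant identity makes it divide \<open>d\<^sup>2 - 1\<close>.\<close>
  have "card F \<le> d\<^sup>2"
  proof -
    have "(card F)\<^sup>2 * (d\<^sup>2 - 1) = 4 * (card F - 1) * (n - 2)"
      using e2 by (simp add: diff_mult_distrib2)
    then have "card F - 1 dvd (card F)\<^sup>2 * (d\<^sup>2 - 1)" by simp
    moreover have "coprime (card F - 1) ((card F)\<^sup>2)"
      using card_F coprime_diff_one_left_nat[of "card F"] by simp
    ultimately have "card F - 1 dvd d\<^sup>2 - 1" by (simp add: coprime_dvd_mult_right_iff)
    moreover have "d\<^sup>2 - 1 > 0" using d2 by (simp add: power2_eq_square)
        (metis One_nat_def Suc_1 less_le_trans lessI n_less_m_mult_n pos2 less_trans)
    ultimately have "card F - 1 \<le> d\<^sup>2 - 1" by (rule dvd_imp_le)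
    then show ?thesis using \<open>d\<^sup>2 - 1 > 0\<close> by linarith
  qed
  then show ?thesis
    using that[OF d2 xpos _ e1 _ e2 prime] jj j1 j2 by (simp add: x_def y_def d_def)
qed

end

section \<open>Pade approximants of binomial functions\<close>

unbundle no vec_syntax
unbundle fps_syntax

text \<open>The numerator \<open>pade \<kappa> n m\<close> and the denominator \<open>pade (-\<kappa>) m n\<close> form the Pade approximant of
  type \<open>[n/m]\<close> of \<open>(1 + z) powr \<kappa>\<close>.\<close>

definition pade :: "real \<Rightarrow> nat \<Rightarrow> nat \<Rightarrow> real poly" where
  "pade \<kappa> n m = (\<Sum>i\<le>n. monom (real (m + n - i choose m) * ((\<kappa> + real m) gchoose i)) i)"

definition pade_rem :: "real \<Rightarrow> nat \<Rightarrow> nat \<Rightarrow> real fps" where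
  "pade_rem \<kappa> n m = fps_binomial \<kappa> * fps_of_poly (pade (-\<kappa>) m n) - fps_of_poly (pade \<kappa> n m)"

lemma coeff_pade:
  "coeff (pade \<kappa> n m) i =
     (if i \<le> n then real (m + n - i choose m) * ((\<kappa> + real m) gchoose i) else 0)"
  by (simp add: pade_def coeff_sum)

lemma degree_pade: "degree (pade \<kappa> n m) \<le> n"
  by (rule degree_le) (simp add: coeff_pade)

lemma poly_pade: "poly (pade \<kappa> n m) z = (\<Sum>i\<le>n. coeff (pade \<kappa> n m) i * z ^ i)"
  unfolding coeff_pade by (simp add: pade_def poly_sum poly_monom)

text \<open>Numerator and denominator (\<open>pderiv_pade'\<close>) pick up the same scalar
  \<open>\<kappa> + m\<close>; this makes the derivative of the remainder a multiple of another
  remainder.\<close>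

lemma pderiv_pade: "pderiv (pade \<kappa> (Suc n) m) = smult (\<kappa> + real m) (pade (\<kappa> - 1) n m)"
proof (rule poly_eqI)
  fix i
  have "real (Suc i) * ((\<kappa> + real m) gchoose Suc i) = (\<kappa> + real m) * ((\<kappa> - 1 + real m) gchoose i)"
    using gbinomial_absorption[of i "\<kappa> + real m"] by (simp only: diff_add_eq)
  then show "coeff (pderiv (pade \<kappa> (Suc n) m)) i = coeff (smult (\<kappa> + real m) (pade (\<kappa> - 1) n m)) i"
    by (simp add: coeff_pderiv coeff_pade mult.left_commute del: of_nat_Suc)
qed

text \<open>Pascal's rule and absorption; this is the coefficient identity behind
  \<open>pderiv_pade'\<close>, with \<open>a = m - i\<close>.\<close>

lemma binomial_contiguous:
  fixes \<kappa> :: real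
  shows "(\<kappa> + real i) * real (Suc n + a choose Suc n) + (real n + 1 - \<kappa> - real i) * real (n + a choose Suc n)
     = (\<kappa> + real i + real a) * real (n + a choose n)"
proof -
  have "real (Suc n) * real (n + a choose Suc n) = real a * real (n + a choose n)"
    using binomial_absorb_comp[of "n + a" n] binomial_absorption[of n "n + a"]
    by (metis add_diff_cancel_left' of_nat_mult)
  then show ?thesis by (simp add: algebra_simps)
qed

text \<open>The left side is the cofactor of \<open>(1 + z) powr (\<kappa> - 1)\<close> in the
  derivative of \<open>(1 + z) powr \<kappa>\<close> times the denominator.\<close>

lemma pderiv_pade':
  "smult \<kappa> (pade (-\<kappa>) m (Suc n)) + [:1, 1:] * pderiv (pade (-\<kappa>) m (Suc n))
     = smult (\<kappa> + real m) (pade (-(\<kappa> - 1)) m n)"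
proof (rule poly_eqI)
  fix i
  let ?Q = "pade (-\<kappa>) m (Suc n)" and ?g = "(real n + 1 - \<kappa>) gchoose i"
  have g: "(1 + real i) * ((real n + 1 - \<kappa>) gchoose Suc i) = (real n + 1 - \<kappa> - real i) * ?g"
    using gbinomial_mult_1[of "real n + 1 - \<kappa>" i] by (simp add: algebra_simps)
  have lhs: "coeff (smult \<kappa> ?Q + [:1, 1:] * pderiv ?Q) i =
      (\<kappa> + real i) * coeff ?Q i + (1 + real i) * coeff ?Q (Suc i)"
    by (cases i) (simp_all add: coeff_pderiv algebra_simps)
  show "coeff (smult \<kappa> ?Q + [:1, 1:] * pderiv ?Q) i
      = coeff (smult (\<kappa> + real m) (pade (-(\<kappa> - 1)) m n)) i"
  proof (cases "i \<le> m")
    case False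
    then show ?thesis unfolding lhs by (simp add: coeff_pade)
  next
    case True
    define a where "a = m - i"
    have m: "m = i + a" using True by (simp add: a_def)
    have q1: "(1 + real i) * coeff ?Q (Suc i) = real (n + a choose Suc n) * ((real n + 1 - \<kappa> - real i) * ?g)"
    proof (cases "a = 0")
      case True
      then show ?thesis using m by (simp add: coeff_pade)
    next
      case False
      then have "coeff ?Q (Suc i) = real (n + a choose Suc n) * ((real n + 1 - \<kappa>) gchoose Suc i)"
        using m by (simp add: coeff_pade algebra_simps)
      then show ?thesis using g by (simp add: mult.left_commute del: gbinomial_Suc0)
    qed
    have q0: "coeff ?Q i = real (Suc n + a choose Suc n) * ?g"
      using m by (simp add: coeff_pade algebra_simps)
    have t: "coeff (pade (-(\<kappa> - 1)) m n) i = real (n + a choose n) * ?g"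
      using m by (simp add: coeff_pade algebra_simps)
    have "coeff (smult \<kappa> ?Q + [:1, 1:] * pderiv ?Q) i =
      ((\<kappa> + real i) * real (Suc n + a choose Suc n) + (real n + 1 - \<kappa> - real i) * real (n + a choose Suc n)) * ?g"
      unfolding lhs q0 q1 by (simp only: algebra_simps)
    also have "\<dots> = (\<kappa> + real m) * (real (n + a choose n) * ?g)"
      unfolding binomial_contiguous using m by simp
    finally show ?thesis unfolding coeff_smult t .
  qed
qed

lemma fps_deriv_binomial: "fps_deriv (fps_binomial \<kappa>) = fps_const \<kappa> * fps_binomial (\<kappa> - 1 :: real)"
  using gbinomial_absorption[of _ \<kappa>] by (intro fps_ext) simp

lemma fps_binomial_step: "fps_binomial (\<kappa> :: real) = fps_binomial (\<kappa> - 1) * (1 + fps_X)"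
  using fps_binomial_add_mult[of "\<kappa> - 1" 1] fps_binomial_of_nat[of 1, where 'a = real] by simp

lemma fps_deriv_pade_rem:
  "fps_deriv (pade_rem \<kappa> (Suc n) m) = fps_const (\<kappa> + real m) * pade_rem (\<kappa> - 1) n m"
proof -
  let ?Q = "pade (-\<kappa>) m (Suc n)" and ?b = "fps_binomial (\<kappa> - 1)"
  have "fps_deriv (pade_rem \<kappa> (Suc n) m) =
    fps_const \<kappa> * ?b * fps_of_poly ?Q + ?b * (1 + fps_X) * fps_of_poly (pderiv ?Q)
      - fps_of_poly (pderiv (pade \<kappa> (Suc n) m))"
    unfolding pade_rem_def
    by (simp add: fps_deriv_binomial fps_of_poly_pderiv fps_binomial_step[of \<kappa>, symmetric])
  also have "\<dots> = ?b * fps_of_poly (smult \<kappa> ?Q + [:1, 1:] * pderiv ?Q)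
      - fps_of_poly (pderiv (pade \<kappa> (Suc n) m))"
    by (simp add: fps_of_poly_add fps_of_poly_mult fps_of_poly_smult fps_of_poly_pCons algebra_simps)
  also have "\<dots> = fps_const (\<kappa> + real m) * pade_rem (\<kappa> - 1) n m"
    unfolding pderiv_pade pderiv_pade' pade_rem_def fps_of_poly_smult by (simp add: algebra_simps)
  finally show ?thesis .
qed

text \<open>The remainder vanishes to order \<open>m + n + 1\<close> since its derivative is a multiple of the
  remainder for \<open>\<kappa> - 1\<close> and \<open>n - 1\<close>.\<close>

lemma pade_rem_nth_eq_0: "l \<le> m + n \<Longrightarrow> pade_rem \<kappa> n m $ l = 0"
proof (induction n arbitrary: \<kappa> l)
  case 0
  \<comment> \<open>For \<open>n = 0\<close> the denominator is the inverse series truncated after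
    degree \<open>m\<close>; up to that degree the convolution is a full Vandermonde sum.\<close>
  have "(fps_binomial \<kappa> * fps_of_poly (pade (-\<kappa>) m 0)) $ l =
      (\<Sum>i=0..l. (\<kappa> gchoose i) * ((-\<kappa>) gchoose (l - i)))"
    unfolding fps_mult_nth using 0 by (intro sum.cong) (auto simp: coeff_pade)
  also have "\<dots> = (if l = 0 then 1 else 0)"
    unfolding gbinomial_Vandermonde by (simp add: gbinomial_0_left)
  finally show ?case by (simp add: pade_rem_def coeff_pade)
next
  case (Suc n)
  show ?case
  proof (cases l)
    case 0
    \<comment> \<open>The constant term is invisible to the derivative; it vanishes by the symmetry
      of binomial coefficients.\<close>
    then show ?thesis
      using binomial_symmetric[of m "m + Suc n"] by (simp add: pade_rem_def coeff_pade add.commute)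
  next
    case (Suc k)
    have "real (Suc k) * pade_rem \<kappa> (Suc n) m $ Suc k = fps_deriv (pade_rem \<kappa> (Suc n) m) $ k"
      by simp
    also have "\<dots> = 0"
      using Suc.IH[of k "\<kappa> - 1"] Suc.prems Suc by (simp add: fps_deriv_pade_rem)
    finally show ?thesis using Suc by simp
  qed
qed

lemma coeff_mult_degree_bounds:
  fixes p q :: "'a::comm_semiring_1 poly"
  assumes "degree p \<le> a" "degree q \<le> b"
  shows "coeff (p * q) (a + b) = coeff p a * coeff q b"
proof -
  have "coeff (p * q) (a + b) = (\<Sum>i\<le>a + b. if i = a then coeff p a * coeff q b else 0)"
    unfolding coeff_mult
  proof (intro sum.cong refl)
    fix i assume "i \<in> {..a + b}"
    then show "coeff p i * coeff q (a + b - i) = (if i = a then coeff p a * coeff q b else 0)"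
      using assms coeff_eq_0[of p i] coeff_eq_0[of q "a + b - i"]
      by (cases i a rule: linorder_cases) auto
  qed
  then show ?thesis by simp
qed

text \<open>The determinant is a combination of two remainders, so it vanishes to order
  \<open>m + n + 1\<close>, and its degree is at most \<open>m + n + 1\<close>. Only one term
  survives, from the leading coefficients of the second product.\<close>

lemma pade_determinant:
  "pade \<kappa> n m * pade (-\<kappa>) m (Suc n) - pade \<kappa> (Suc n) m * pade (-\<kappa>) m n =
   monom (- (((\<kappa> + real m) gchoose Suc n) * ((real n - \<kappa>) gchoose m))) (m + n + 1)"
   (is "?P1 * ?Q2 - ?P2 * ?Q1 = monom ?c _")
proof (rule poly_eqI)
  fix l
  consider "l \<le> m + n" | "l = m + n + 1" | "l > m + n + 1" by linarith
  then show "coeff (?P1 * ?Q2 - ?P2 * ?Q1) l = coeff (monom ?c (m + n + 1)) l"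
  proof cases
    case 1
    have "fps_of_poly (?P1 * ?Q2 - ?P2 * ?Q1) =
        pade_rem \<kappa> (Suc n) m * fps_of_poly ?Q1 - pade_rem \<kappa> n m * fps_of_poly ?Q2"
      by (simp add: pade_rem_def fps_of_poly_diff fps_of_poly_mult algebra_simps)
    then have "coeff (?P1 * ?Q2 - ?P2 * ?Q1) l =
        (pade_rem \<kappa> (Suc n) m * fps_of_poly ?Q1 - pade_rem \<kappa> n m * fps_of_poly ?Q2) $ l"
      by (metis fps_of_poly_nth)
    also have "\<dots> = 0" using 1 by (simp add: fps_mult_nth pade_rem_nth_eq_0)
    finally show ?thesis using 1 by simp
  next
    case 2
    have "degree (?P1 * ?Q2) \<le> n + m"
      using degree_mult_le[of ?P1 ?Q2] degree_pade[of \<kappa> n m] degree_pade[of "-\<kappa>" m "Suc n"] by linarith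
    then have "coeff (?P1 * ?Q2) l = 0" using 2 by (intro coeff_eq_0) simp
    moreover have "coeff (?P2 * ?Q1) l = coeff ?P2 (Suc n) * coeff ?Q1 m"
      using coeff_mult_degree_bounds[OF degree_pade[of \<kappa> "Suc n" m] degree_pade[of "-\<kappa>" m n]] 2
      by (simp add: add.commute)
    ultimately show ?thesis using 2 by (simp add: coeff_pade)
  next
    case 3
    have "degree (?P1 * ?Q2) \<le> n + m" "degree (?P2 * ?Q1) \<le> Suc n + m"
      using degree_mult_le[of ?P1 ?Q2] degree_pade[of \<kappa> n m] degree_pade[of "-\<kappa>" m "Suc n"]
         degree_mult_le[of ?P2 ?Q1] degree_pade[of \<kappa> "Suc n" m] degree_pade[of "-\<kappa>" m n] by linarith+
    then show ?thesis using 3 by (simp add: coeff_eq_0)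
  qed
qed

section \<open>Convergence and size of the Pade remainder\<close>

lemma sums_fps_mult_poly:
  fixes z s :: real
  assumes "(\<lambda>l. F $ l * z ^ l) sums s"
  shows "(\<lambda>l. (F * fps_of_poly p) $ l * z ^ l) sums (s * poly p z)"
proof (induction p)
  case 0
  then show ?case by simp
next
  case (pCons a p)
  let ?G = "F * fps_of_poly p"
  have eq: "F * fps_of_poly (pCons a p) = fps_const a * F + ?G * fps_X"
    by (simp add: fps_of_poly_pCons algebra_simps)
  have nth: "(?G * fps_X) $ Suc l = ?G $ l" for l by simp
  have "(\<lambda>l. (?G * fps_X) $ Suc l * z ^ Suc l) sums (z * (s * poly p z))"
    using sums_mult[OF pCons.IH, of z] unfolding nth power_Suc by (simp add: mult.left_commute)
  then have "(\<lambda>l. (?G * fps_X) $ l * z ^ l) sums (z * (s * poly p z))"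
    by (subst (asm) sums_Suc_iff) simp
  from sums_add[OF sums_mult[OF assms, of a] this] show ?case
    unfolding eq by (simp add: algebra_simps)
qed

lemma pade_rem_sums:
  fixes z :: real
  assumes "\<bar>z\<bar> < 1"
  shows "(\<lambda>l. pade_rem \<kappa> n m $ l * z ^ l) sums
    ((1 + z) powr \<kappa> * poly (pade (-\<kappa>) m n) z - poly (pade \<kappa> n m) z)"
proof -
  have "(\<lambda>l. fps_binomial \<kappa> $ l * z ^ l) sums (1 + z) powr \<kappa>"
    using gen_binomial_real[OF assms] by simp
  from sums_fps_mult_poly[OF this]
  have 1: "(\<lambda>l. (fps_binomial \<kappa> * fps_of_poly (pade (-\<kappa>) m n)) $ l * z ^ l) sums
     ((1 + z) powr \<kappa> * poly (pade (-\<kappa>) m n) z)" .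
  have "(\<lambda>l. (1 :: real fps) $ l * z ^ l) = (\<lambda>l. if l = 0 then 1 else 0)" by auto
  then have "(\<lambda>l. (1 :: real fps) $ l * z ^ l) sums 1" using sums_single[of 0 "\<lambda>_. 1::real"] by simp
  from sums_fps_mult_poly[OF this]
  have 2: "(\<lambda>l. fps_of_poly (pade \<kappa> n m) $ l * z ^ l) sums poly (pade \<kappa> n m) z" by simp
  from sums_diff[OF 1 2] show ?thesis by (simp add: pade_rem_def algebra_simps)
qed

text \<open>Comparison with \<open>A + i choose i\<close> factor by factor: the factor
  \<open>a - j\<close> is at most \<open>A + j + 1\<close> in absolute value.\<close>

lemma abs_gbinomial_le:
  fixes a :: real
  assumes "\<bar>a\<bar> \<le> real A"
  shows "\<bar>a gchoose i\<bar> \<le> 2 ^ (A + i)"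
proof -
  have "\<bar>a gchoose i\<bar> \<le> real (A + i choose i)"
  proof (induction i)
    case (Suc i)
    have "real (Suc i) * (a gchoose Suc i) = (a - real i) * (a gchoose i)"
      using gbinomial_mult_1[of a i] by (simp add: algebra_simps)
    then have "real (Suc i) * \<bar>a gchoose Suc i\<bar> = \<bar>a - real i\<bar> * \<bar>a gchoose i\<bar>"
      by (metis abs_mult abs_of_nat)
    also have "\<dots> \<le> real (Suc (A + i)) * real (A + i choose i)"
      using assms by (intro mult_mono Suc.IH) auto
    also have "\<dots> = real (Suc i) * real (A + Suc i choose Suc i)"
      using Suc_times_binomial_eq[of "A + i" i]
      by (metis add_Suc_right mult.commute of_nat_mult)
    finally show ?case by (simp del: of_nat_Suc binomial_Suc_Suc)
  qed simp
  also have "\<dots> \<le> 2 ^ (A + i)"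
    using binomial_le_pow2[of "A + i" i] by (metis of_nat_le_iff of_nat_numeral of_nat_power)
  finally show ?thesis .
qed

lemma abs_coeff_pade_le:
  assumes "\<bar>\<kappa>\<bar> \<le> real K"
  shows "\<bar>coeff (pade \<kappa> n m) i\<bar> \<le> 2 ^ (2 * m + n + K + i)"
proof (cases "i \<le> n")
  case True
  have "real (m + n - i choose m) \<le> 2 ^ (m + n - i)"
    using binomial_le_pow2[of "m + n - i" m] by (metis of_nat_le_iff of_nat_numeral of_nat_power)
  also have "\<dots> \<le> 2 ^ (m + n)" by (intro power_increasing) auto
  finally have "\<bar>coeff (pade \<kappa> n m) i\<bar> \<le> 2 ^ (m + n) * 2 ^ ((K + m) + i)"
    using True assms abs_gbinomial_le[of "\<kappa> + real m" "K + m" i]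
    by (simp only: coeff_pade if_True abs_mult abs_of_nat) (intro mult_mono; simp)
  also have "\<dots> = (2 ^ (2 * m + n + K + i) :: real)"
    by (simp add: power_add[symmetric] algebra_simps)
  finally show ?thesis .
qed (simp add: coeff_pade)

lemma abs_poly_pade_le:
  assumes "\<bar>\<kappa>\<bar> \<le> real K" "\<bar>z\<bar> \<le> 1/4"
  shows "\<bar>poly (pade \<kappa> n m) z\<bar> \<le> 2 ^ (2 * m + n + K + 1)"
proof -
  have "poly (pade \<kappa> n m) z = (\<Sum>i\<le>n. coeff (pade \<kappa> n m) i * z ^ i)"
    by (rule poly_pade)
  also have "\<bar>\<dots>\<bar> \<le> (\<Sum>i\<le>n. 2 ^ (2 * m + n + K) * (1/2) ^ i)"
  proof (intro order.trans[OF sum_abs] sum_mono)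
    fix i
    have "\<bar>coeff (pade \<kappa> n m) i * z ^ i\<bar> \<le> 2 ^ (2 * m + n + K + i) * (1/4) ^ i"
      unfolding abs_mult power_abs
      using assms by (intro mult_mono abs_coeff_pade_le power_mono) auto
    also have "\<dots> = 2 ^ (2 * m + n + K) * (1/2) ^ i"
      by (simp add: power_add power_mult_distrib[symmetric])
    finally show "\<bar>coeff (pade \<kappa> n m) i * z ^ i\<bar> \<le> 2 ^ (2 * m + n + K) * (1/2) ^ i" .
  qed
  also have "\<dots> = 2 ^ (2 * m + n + K) * (\<Sum>i\<le>n. (1/2) ^ i)"
    by (simp add: sum_distrib_left)
  also have "(\<Sum>i\<le>n. (1/2 :: real) ^ i) \<le> 2"
    by (simp add: sum_gp0)
  finally show ?thesis by simp
qed

lemma abs_pade_rem_nth_le: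
  assumes "\<bar>\<kappa>\<bar> \<le> real K"
  shows "\<bar>pade_rem \<kappa> n m $ l\<bar> \<le> 2 ^ (2 * K + 2 * m + 2 * n + 1) * 4 ^ l"
proof -
  let ?E = "2 * K + 2 * m + 2 * n + l"
  have "\<bar>(fps_binomial \<kappa> * fps_of_poly (pade (-\<kappa>) m n)) $ l\<bar> \<le> (\<Sum>i=0..l. 2 ^ ?E)"
    unfolding fps_mult_nth
  proof (intro order.trans[OF sum_abs] sum_mono)
    fix i assume i: "i \<in> {0..l}"
    have "\<bar>fps_binomial \<kappa> $ i * fps_of_poly (pade (-\<kappa>) m n) $ (l - i)\<bar>
       \<le> 2 ^ (K + i) * 2 ^ (2 * n + m + K + (l - i))"
      unfolding abs_mult fps_of_poly_nth fps_binomial_nth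
      using assms by (intro mult_mono abs_gbinomial_le abs_coeff_pade_le) auto
    also have "\<dots> = 2 ^ (2 * n + m + 2 * K + l)"
      unfolding power_add[symmetric] using i by (intro arg_cong[of _ _ "\<lambda>k. 2 ^ k"]) auto
    also have "\<dots> \<le> 2 ^ ?E" by (intro power_increasing) auto
    finally show "\<bar>fps_binomial \<kappa> $ i * fps_of_poly (pade (-\<kappa>) m n) $ (l - i)\<bar> \<le> 2 ^ ?E" .
  qed
  also have "\<dots> = real (Suc l) * 2 ^ ?E" by simp
  also have "\<dots> \<le> 2 ^ l * 2 ^ ?E"
  proof (intro mult_right_mono)
    have "Suc l \<le> 2 ^ l" by (rule Suc_leI[OF less_exp])
    then show "real (Suc l) \<le> 2 ^ l" by (metis of_nat_le_iff of_nat_numeral of_nat_power)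
  qed simp
  finally have 1: "\<bar>(fps_binomial \<kappa> * fps_of_poly (pade (-\<kappa>) m n)) $ l\<bar> \<le> 2 ^ l * 2 ^ ?E" .
  have "\<bar>fps_of_poly (pade \<kappa> n m) $ l\<bar> \<le> 2 ^ (2 * m + n + K + l)"
    using abs_coeff_pade_le[OF assms] by simp
  also have "\<dots> \<le> (2 ^ (l + ?E) :: real)" by (intro power_increasing) auto
  finally have 2: "\<bar>fps_of_poly (pade \<kappa> n m) $ l\<bar> \<le> 2 ^ l * 2 ^ ?E" by (simp only: power_add[of 2 l])
  have "\<bar>pade_rem \<kappa> n m $ l\<bar> \<le> 2 * (2 ^ l * 2 ^ ?E)"
    unfolding pade_rem_def fps_sub_nth using 1 2 by linarith
  also have "\<dots> = 2 ^ (2 * K + 2 * m + 2 * n + 1) * (2 ^ l * 2 ^ l)"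
    by (simp add: power_add)
  also have "(2 ^ l * 2 ^ l :: real) = 4 ^ l" by (simp add: power_mult_distrib[symmetric])
  finally show ?thesis .
qed

text \<open>The series starts at exponent \<open>m + n + 1\<close> and is dominated by a geometric
  series of ratio \<open>4 * \<bar>z\<bar>\<close>, which the bound 1/8 keeps at most 1/2.\<close>

lemma abs_pade_error_le:
  fixes z :: real
  assumes \<kappa>: "\<bar>\<kappa>\<bar> \<le> real K" and z: "\<bar>z\<bar> \<le> 1/8"
  shows "\<bar>(1 + z) powr \<kappa> * poly (pade (-\<kappa>) m n) z - poly (pade \<kappa> n m) z\<bar>
     \<le> 2 ^ (2 * K + 4 * m + 4 * n + 4) * \<bar>z\<bar> ^ (m + n + 1)"
    (is "\<bar>?s\<bar> \<le> _")
proof -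
  let ?N = "m + n + 1" and ?C = "2 ^ (2 * K + 2 * m + 2 * n + 1) :: real"
  have "(\<lambda>l. pade_rem \<kappa> n m $ l * z ^ l) sums ?s"
    by (rule pade_rem_sums) (use z in auto)
  then have 1: "(\<lambda>l. pade_rem \<kappa> n m $ (l + ?N) * z ^ (l + ?N)) sums ?s"
    using sums_iff_shift[of "\<lambda>l. pade_rem \<kappa> n m $ l * z ^ l" ?N ?s] by (simp add: pade_rem_nth_eq_0)
  have "(\<lambda>l. (4 * \<bar>z\<bar>) ^ l) sums (1 / (1 - 4 * \<bar>z\<bar>))"
    by (rule geometric_sums) (use z in auto)
  then have 2: "(\<lambda>l. ?C * (4 * \<bar>z\<bar>) ^ ?N * (4 * \<bar>z\<bar>) ^ l) sums (?C * (4 * \<bar>z\<bar>) ^ ?N * (1 / (1 - 4 * \<bar>z\<bar>)))"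
    by (rule sums_mult)
  have "norm ?s \<le> ?C * (4 * \<bar>z\<bar>) ^ ?N * (1 / (1 - 4 * \<bar>z\<bar>))"
  proof (rule norm_sums_le[OF 1 2])
    fix l
    have "norm (pade_rem \<kappa> n m $ (l + ?N) * z ^ (l + ?N)) \<le> ?C * 4 ^ (l + ?N) * \<bar>z\<bar> ^ (l + ?N)"
      unfolding real_norm_def abs_mult power_abs
      by (intro mult_right_mono abs_pade_rem_nth_le \<kappa>) auto
    also have "\<dots> = ?C * (4 * \<bar>z\<bar>) ^ ?N * (4 * \<bar>z\<bar>) ^ l"
      by (simp only: power_mult_distrib power_add mult_ac)
    finally show "norm (pade_rem \<kappa> n m $ (l + ?N) * z ^ (l + ?N))
        \<le> ?C * (4 * \<bar>z\<bar>) ^ ?N * (4 * \<bar>z\<bar>) ^ l" .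
  qed
  also have "\<dots> \<le> ?C * (4 * \<bar>z\<bar>) ^ ?N * 2"
    using z by (intro mult_left_mono) (auto simp: field_simps)
  also have "\<dots> = ?C * 4 ^ ?N * 2 * \<bar>z\<bar> ^ ?N" by (simp only: power_mult_distrib mult_ac)
  also have "(4::real) ^ ?N = 2 ^ (2 * ?N)" by (simp only: power_mult) simp
  also have "?C * 2 ^ (2 * ?N) * 2 = 2 ^ (2 * K + 4 * m + 4 * n + 4)"
    by (simp add: power_add[symmetric] power_Suc[symmetric] algebra_simps del: power_Suc)
  finally show ?thesis by simp
qed

section \<open>Denominators of the Pade coefficients\<close>

lemma gbinomial_of_int_Ints: "(of_int c gchoose i :: real) \<in> \<int>"
  by (simp flip: of_int_gbinomial)

lemma gbinomial_minus_half_Ints: "4 ^ i * ((-1/2 :: real) gchoose i) = (-1) ^ i * real (2 * i choose i)"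
proof (induction i)
  case (Suc i)
  have g: "real (Suc i) * ((-1/2 :: real) gchoose Suc i) = (-1/2 - real i) * ((-1/2) gchoose i)"
    using gbinomial_mult_1[of "-1/2::real" i] by (simp add: algebra_simps)
  have "Suc i * (2 * Suc i choose Suc i) = 2 * (2 * i + 1) * (2 * i choose i)"
  proof -
    have "Suc i * (Suc i * (2 * Suc i choose Suc i)) = Suc i * (Suc (2 * i + 1) * (2 * i + 1 choose i))"
      using Suc_times_binomial_eq[of "2 * i + 1" i] by (simp add: mult.commute)
    also have "\<dots> = 2 * Suc i * (Suc i * (2 * i + 1 choose i))" by simp
    also have "2 * i + 1 choose i = 2 * i + 1 choose Suc i"
      using binomial_symmetric[of i "2 * i + 1"] by simp
    also have "Suc i * (2 * i + 1 choose Suc i) = (2 * i + 1) * (2 * i choose i)"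
      using Suc_times_binomial_eq[of "2 * i" i] by (simp add: mult.commute)
    finally have "Suc i * (Suc i * (2 * Suc i choose Suc i)) = Suc i * (2 * (2 * i + 1) * (2 * i choose i))"
      by (simp only: mult_ac)
    then show ?thesis unfolding mult_cancel1 using Suc_not_Zero[of i] by blast
  qed
  then have "real (Suc i * (2 * Suc i choose Suc i)) = real (2 * (2 * i + 1) * (2 * i choose i))"
    by (simp only:)
  then have b: "real (Suc i) * real (2 * Suc i choose Suc i) = 2 * (2 * real i + 1) * real (2 * i choose i)"
    by (simp only: of_nat_mult of_nat_add of_nat_numeral of_nat_1)
  have "real (Suc i) * (4 ^ Suc i * ((-1/2 :: real) gchoose Suc i)) =
      4 * 4 ^ i * (real (Suc i) * ((-1/2) gchoose Suc i))"
    by (simp only: power_Suc mult_ac)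
  also have "\<dots> = 4 * (-1/2 - real i) * (4 ^ i * ((-1/2) gchoose i))"
    unfolding g by (simp only: mult_ac)
  also have "\<dots> = (-1) ^ Suc i * (2 * (2 * real i + 1) * real (2 * i choose i))"
    unfolding Suc.IH by (simp add: algebra_simps)
  also have "\<dots> = real (Suc i) * ((-1) ^ Suc i * real (2 * Suc i choose Suc i))"
    unfolding b[symmetric] by (simp only: mult.left_commute)
  finally show ?case unfolding mult_left_cancel[OF of_nat_neq_0] .
qed simp

text \<open>A half-integer outside the integers is \<open>-1/2\<close> plus an integer.
  Vandermonde's identity then distributes \<open>4 ^ i\<close> over the two binomials, the first of
  which is a central binomial coefficient up to sign.\<close>

lemma gbinomial_half_Ints:
  fixes \<kappa> :: real
  assumes "2 * \<kappa> \<in> \<int>"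
  shows "4 ^ i * (\<kappa> gchoose i) \<in> \<int>"
proof -
  obtain c where c: "2 * \<kappa> = of_int c" using assms by (auto elim: Ints_cases)
  show ?thesis
  proof (cases "even c")
    case True
    then obtain e where "c = 2 * e" by blast
    then have "\<kappa> = of_int e" using c by simp
    then show ?thesis using gbinomial_of_int_Ints[of e i] by simp
  next
    case False
    then obtain e where "c = 2 * e + 1" by (rule oddE)
    then have "\<kappa> = -1/2 + of_int (e + 1)" using c by simp
    then have "4 ^ i * (\<kappa> gchoose i) = 4 ^ i * (\<Sum>k=0..i. ((-1/2) gchoose k) * (of_int (e + 1) gchoose (i - k)))"
      by (simp only: gbinomial_Vandermonde)
    also have "\<dots> = (\<Sum>k=0..i. (4 ^ k * ((-1/2) gchoose k)) * (4 ^ (i - k) * (of_int (e + 1) gchoose (i - k))))"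
      unfolding sum_distrib_left
    proof (intro sum.cong refl)
      fix k assume "k \<in> {0..i}"
      then have "(4::real) ^ i = 4 ^ k * 4 ^ (i - k)" by (simp add: power_add[symmetric])
      then show "4 ^ i * (((-1/2) gchoose k) * (of_int (e + 1) gchoose (i - k))) =
         (4 ^ k * ((-1/2 :: real) gchoose k)) * (4 ^ (i - k) * (of_int (e + 1) gchoose (i - k)))"
        by (simp only: mult_ac)
    qed
    also have "\<dots> \<in> \<int>"
      unfolding gbinomial_minus_half_Ints
      by (intro Ints_sum Ints_mult Ints_power gbinomial_of_int_Ints) auto
    finally show ?thesis .
  qed
qed

text \<open>Each degree costs one factor \<open>w\<close> for \<open>D / w\<close> and one factor 4
  for the half-integer binomial. The slack \<open>N \<ge> n\<close> lets numerators of degree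
  \<open>n\<close> and \<open>n + 1\<close> share a multiplier.\<close>

lemma poly_pade_Ints:
  fixes \<kappa> :: real and D w :: int
  assumes \<kappa>: "2 * \<kappa> \<in> \<int>" and w: "w \<noteq> 0" and N: "N \<ge> n"
  shows "(4 * w) ^ N * poly (pade \<kappa> n m) (D / w) \<in> \<int>"
proof -
  have "(4 * w) ^ N * poly (pade \<kappa> n m) (D / w) =
     (\<Sum>i\<le>n. real (m + n - i choose m) * (4 ^ i * ((\<kappa> + real m) gchoose i)) * (4 * w) ^ (N - i) * D ^ i)"
    unfolding poly_pade sum_distrib_left
  proof (intro sum.cong refl)
    fix i assume i: "i \<in> {..n}"
    define W where "W = real_of_int w"
    have "N = (N - i) + i" using i N by simp
    then have 1: "(4 * W) ^ N = (4 * W) ^ (N - i) * (4 * W) ^ i" by (metis power_add)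
    have "W \<noteq> 0" using w by (simp add: W_def)
    then have WD: "4 * W * (D / W) = 4 * D" by simp
    have 2: "(4 * W) ^ i * (D / W) ^ i = 4 ^ i * real_of_int D ^ i"
      unfolding power_mult_distrib[symmetric] WD by (simp add: power_mult_distrib)
    have c: "coeff (pade \<kappa> n m) i = real (m + n - i choose m) * ((\<kappa> + real m) gchoose i)"
      using i by (simp add: coeff_pade)
    have "(4 * W) ^ N * (coeff (pade \<kappa> n m) i * (D / W) ^ i) =
       coeff (pade \<kappa> n m) i * (4 * W) ^ (N - i) * ((4 * W) ^ i * (D / W) ^ i)"
      unfolding 1 by (simp only: mult_ac)
    also have "\<dots> = real (m + n - i choose m) * (4 ^ i * ((\<kappa> + real m) gchoose i)) * (4 * W) ^ (N - i) * real_of_int D ^ i"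
      unfolding 2 c by (simp only: mult_ac)
    finally show "(4 * w) ^ N * (coeff (pade \<kappa> n m) i * (D / w) ^ i) =
      real (m + n - i choose m) * (4 ^ i * ((\<kappa> + real m) gchoose i)) * (4 * w) ^ (N - i) * D ^ i"
      by (simp add: W_def)
  qed
  also have "\<dots> \<in> \<int>"
  proof -
    have "2 * (\<kappa> + real m) \<in> \<int>" using \<kappa> by (simp add: distrib_left)
    from gbinomial_half_Ints[OF this] show ?thesis
      by (intro Ints_sum Ints_mult[OF Ints_mult[OF Ints_mult]]) auto
  qed
  finally show ?thesis .
qed

text \<open>Since consecutive approximants are not proportional at \<open>D / w\<close>, one of them satisfies the last
  condition.\<close>

lemma pade_approximation:
  fixes \<kappa> U W :: real and D w :: int
  assumes \<kappa>: "2 * \<kappa> \<in> \<int>" "\<bar>\<kappa>\<bar> \<le> real K"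
    and nz: "(\<kappa> + real m) gchoose Suc n \<noteq> 0" "(real n - \<kappa>) gchoose m \<noteq> 0"
    and w: "w > 0" and D: "D \<noteq> 0" "\<bar>D\<bar> * 8 \<le> w" and U: "U \<noteq> 0"
  obtains P Q :: real where
    "\<bar>P\<bar> \<le> 2 ^ (2 * K + 4 * m + 4 * n + 8)" "\<bar>Q\<bar> \<le> 2 ^ (2 * K + 4 * m + 4 * n + 8)"
    "\<bar>Q * (1 + D / w) powr \<kappa> - P\<bar> \<le> 2 ^ (2 * K + 4 * m + 4 * n + 8) * \<bar>D / w\<bar> ^ (m + n + 1)"
    "(4 * w) ^ (n + 1) * P \<in> \<int>" "(4 * w) ^ m * Q \<in> \<int>" "Q * U \<noteq> P * W"
proof -
  define z :: real where "z = D / w"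
  have z: "\<bar>z\<bar> \<le> 1/8" 
  proof -
    have "real_of_int (\<bar>D\<bar> * 8) \<le> real_of_int w" using D(2) by (simp only: of_int_le_iff)
    then show ?thesis using w by (simp add: z_def field_simps)
  qed
  have z0: "z \<noteq> 0" using D w by (simp add: z_def)
  define p q where "p j = poly (pade \<kappa> j m) z" and "q j = poly (pade (-\<kappa>) m j) z" for j
  have \<kappa>': "\<bar>-\<kappa>\<bar> \<le> real K" "2 * (-\<kappa>) \<in> \<int>" using \<kappa> by auto
  have z4: "\<bar>z\<bar> \<le> 1/4" using z by simp
  have "poly (pade \<kappa> n m * pade (-\<kappa>) m (Suc n) - pade \<kappa> (Suc n) m * pade (-\<kappa>) m n) z \<noteq> 0"
    unfolding pade_determinant using nz z0 by (simp add: poly_monom)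
  then have det: "p n * q (Suc n) - p (Suc n) * q n \<noteq> 0" by (simp add: p_def q_def)
  have "\<exists>j\<in>{n, Suc n}. q j * U \<noteq> p j * W"
  proof (rule ccontr)
    assume "\<not> ?thesis"
    then have h: "q n * U = p n * W" "q (Suc n) * U = p (Suc n) * W" by auto
    have "(p n * q (Suc n) - p (Suc n) * q n) * U = p n * (q (Suc n) * U) - p (Suc n) * (q n * U)"
      by (simp add: algebra_simps)
    also have "\<dots> = 0" unfolding h by (simp add: algebra_simps)
    finally show False using det U by simp
  qed
  then obtain j where j: "j \<in> {n, Suc n}" "q j * U \<noteq> p j * W" by blast
  show ?thesis
  proof (rule that[of "p j" "q j"])
    have "\<bar>p j\<bar> \<le> 2 ^ (2 * m + j + K + 1)" unfolding p_def by (rule abs_poly_pade_le[OF \<kappa>(2) z4])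
    also have "\<dots> \<le> 2 ^ (2 * K + 4 * m + 4 * n + 8)" using j by (intro power_increasing) auto
    finally show "\<bar>p j\<bar> \<le> 2 ^ (2 * K + 4 * m + 4 * n + 8)" .
    have "\<bar>q j\<bar> \<le> 2 ^ (2 * j + m + K + 1)" unfolding q_def by (rule abs_poly_pade_le[OF \<kappa>'(1) z4])
    also have "\<dots> \<le> 2 ^ (2 * K + 4 * m + 4 * n + 8)" using j by (intro power_increasing) auto
    finally show "\<bar>q j\<bar> \<le> 2 ^ (2 * K + 4 * m + 4 * n + 8)" .
    have "\<bar>q j * (1 + z) powr \<kappa> - p j\<bar> \<le> 2 ^ (2 * K + 4 * m + 4 * j + 4) * \<bar>z\<bar> ^ (m + j + 1)"
      unfolding p_def q_def using abs_pade_error_le[OF \<kappa>(2) z, of m j] by (simp add: mult.commute)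
    \<comment> \<open>The 8 in the exponent, in place of the 4 of \<open>abs_pade_error_le\<close>,
      covers \<open>j = Suc n\<close>.\<close>
    also have "\<dots> \<le> 2 ^ (2 * K + 4 * m + 4 * n + 8) * \<bar>z\<bar> ^ (m + n + 1)"
      using j z by (intro mult_mono power_increasing power_decreasing) auto
    finally show "\<bar>q j * (1 + D / w) powr \<kappa> - p j\<bar>
        \<le> 2 ^ (2 * K + 4 * m + 4 * n + 8) * \<bar>D / w\<bar> ^ (m + n + 1)"
      unfolding z_def .
    show "(4 * w) ^ (n + 1) * p j \<in> \<int>"
      unfolding p_def z_def using j w by (intro poly_pade_Ints[OF \<kappa>(1)]) auto
    show "(4 * w) ^ m * q j \<in> \<int>"
      unfolding q_def z_def using w by (intro poly_pade_Ints[OF \<kappa>'(2)]) auto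
    show "q j * U \<noteq> p j * W" by (rule j(2))
  qed
qed

unbundle no fps_syntax
unbundle vec_syntax

section \<open>Smooth numbers close to powers\<close>

text \<open>The product runs over all primes up to \<open>R\<close>, so that exponent vectors of
  different numbers share one index set.\<close>

lemma smooth_factorization:
  fixes g R :: nat
  assumes "g > 0" "\<And>p. prime p \<Longrightarrow> p dvd g \<Longrightarrow> p \<le> R"
  shows "g = (\<Prod>p\<in>{p. prime p \<and> p \<le> R}. p ^ multiplicity p g)"
proof -
  have "g = (\<Prod>p\<in>prime_factors g. p ^ multiplicity p g)"
    using assms(1) by (simp add: prime_factorization_nat)
  also have "\<dots> = (\<Prod>p\<in>{p. prime p \<and> p \<le> R}. p ^ multiplicity p g)"
    using assms by (intro prod.mono_neutral_left)
      (auto simp: in_prime_factors_iff not_dvd_imp_multiplicity_0)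
  finally show ?thesis .
qed

text \<open>Divide the exponents in the prime factorization of \<open>g k s\<close>
    by \<open>ln s\<close>. By pigeonhole, infinitely many
  \<open>s\<close> have almost the same quotients and the same parities of the exponents. For two of them
  far apart, \<open>g k s'\<close> is close to a power of \<open>g k s\<close> with odd exponent, up to squares.\<close>

lemma smooth_near_power:
  fixes I :: "nat set" and J :: "'k set" and g :: "'k \<Rightarrow> nat \<Rightarrow> nat" and R c h B :: nat
  assumes I: "infinite I" and J: "finite J"
    and g_pos: "\<And>s k. s \<in> I \<Longrightarrow> k \<in> J \<Longrightarrow> g k s > 0"
    and g_le: "\<And>s k. s \<in> I \<Longrightarrow> k \<in> J \<Longrightarrow> g k s \<le> s ^ c"
    and g_smooth: "\<And>s k p. s \<in> I \<Longrightarrow> k \<in> J \<Longrightarrow> prime p \<Longrightarrow> p dvd g k s \<Longrightarrow> p \<le> R"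
  obtains s s' n where "s \<in> I" "s' \<in> I" "s \<ge> B" "n \<ge> B" "s ^ (8 * n) \<le> s'"
    "\<And>k. k \<in> J \<Longrightarrow> \<exists>a b. a > 0 \<and> b > 0 \<and> a ^ h
        \<le> s ^ n \<and> b ^ h \<le> s ^ n \<and>
       g k s' * a\<^sup>2 = g k s ^ (8 * n + 1) * b\<^sup>2"
proof -
  define S where "S = {p::nat. prime p \<and> p \<le> R}"
  have fin_S: "finite S" unfolding S_def by (rule finite_subset[of _ "{..R}"]) auto
  define e where "e k p s = multiplicity p (g k s)" for k p s
  define L where "L s = ln (real s)" for s
  define T where "T = (\<Sum>p\<in>S. ln (real p))"
  have lnp: "ln (real p) \<ge> 0" if "p \<in> S" for p
    using that prime_ge_2_nat[of p] by (auto simp: S_def)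
  have T0: "T \<ge> 0" unfolding T_def by (intro sum_nonneg lnp)
  \<comment> \<open>Without 0 and 1, \<open>L s\<close> is positive and may be divided by.\<close>
  define I0 where "I0 = I - {..1}"
  have I0: "infinite I0" using I by (simp add: I0_def)
  have ln2: "ln (2::real) \<ge> 1/2" using ln2_ge_two_thirds by simp
  have L_ge: "L s \<ge> 1/2" if "s \<in> I0" for s
  proof -
    have "ln 2 \<le> L s" using that by (auto simp: L_def I0_def)
    then show ?thesis using ln2 by linarith
  qed
  have e_le: "real (e k p s) \<le> 2 * real c * L s" if s: "s \<in> I0" and k: "k \<in> J" and p: "p \<in> S" for s k p
  proof -
    have sI: "s \<in> I" "s > 1" using s by (auto simp: I0_def)
    have p2: "p \<ge> 2" using p prime_ge_2_nat by (auto simp: S_def)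
    have "p ^ e k p s dvd g k s" unfolding e_def by (rule multiplicity_dvd)
    then have "p ^ e k p s \<le> s ^ c"
      using g_pos[OF sI(1) k] g_le[OF sI(1) k] dvd_imp_le order.trans by blast
    moreover have "2 ^ e k p s \<le> p ^ e k p s" using p2 by (rule power_mono) simp
    ultimately have "2 ^ e k p s \<le> s ^ c" by linarith
    then have "real (2 ^ e k p s) \<le> real (s ^ c)" by (simp only: of_nat_le_iff)
    then have "ln (2 ^ e k p s) \<le> ln (real s ^ c)" using sI by (subst ln_le_cancel_iff) auto
    then have "real (e k p s) * ln 2 \<le> real c * L s"
      using sI by (simp add: ln_realpow L_def)
    moreover have "real (e k p s) * (1/2) \<le> real (e k p s) * ln 2"
      using ln2 by (intro mult_left_mono) auto
    ultimately show ?thesis by linarith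
  qed
  \<comment> \<open>\<open>H\<close> is the fineness of the rounding, chosen to make
    \<open>h * T / H\<close> at most 1/32.\<close>
  obtain H :: nat where H: "real H > 32 * real h * T + 1" using reals_Archimedean2 by blast
  then have H0: "real H > 0" using T0 by (smt (verit) mult_nonneg_nonneg of_nat_0_le_iff)
  define \<phi> where "\<phi> s = (\<lambda>(k,p)\<in>J \<times> S. (\<lfloor>real H * (real (e k p s) / L s)\<rfloor>, e k p s mod 2))" for s
  have "\<phi> ` I0 \<subseteq> PiE (J \<times> S) (\<lambda>_. {0..int (2 * c * H)} \<times> {0..1})"
  proof (clarsimp simp: \<phi>_def PiE_iff extensional_def)
    fix s k p assume s: "s \<in> I0" "k \<in> J" "p \<in> S"
    have L: "L s > 0" using L_ge[OF s(1)] by linarith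
    have "real (e k p s) / L s \<le> 2 * real c" using e_le[OF s] L by (simp add: field_simps)
    then have "real H * (real (e k p s) / L s) \<le> real H * (2 * real c)" by (intro mult_left_mono) auto
    then have "real H * (real (e k p s) / L s) \<le> real_of_int (int (2 * c * H))" by (simp add: mult_ac)
    then have "\<lfloor>real H * (real (e k p s) / L s)\<rfloor> \<le> int (2 * c * H)" by linarith
    then show "0 \<le> real H * real (e k p s) / L s \<and>
       \<lfloor>real H * real (e k p s) / L s\<rfloor> \<le> 2 * int c * int H \<and> e k p s mod 2 \<le> Suc 0"
      using L by (simp add: divide_nonneg_pos)
  qed
  moreover have "finite (PiE (J \<times> S) (\<lambda>_. {0..int (2 * c * H)} \<times> {0..1::nat}))"
    using J fin_S by (intro finite_PiE) auto
  ultimately have "finite (\<phi> ` I0)" by (rule finite_subset)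
  from pigeonhole_infinite[OF I0 this] obtain s0 where "infinite {s\<in>I0. \<phi> s = \<phi> s0}" by blast
  define I1 where "I1 = {s\<in>I0. \<phi> s = \<phi> s0}"
  have I1: "infinite I1" unfolding I1_def by fact
  have close: "\<bar>real (e k p s) / L s - real (e k p s') / L s'\<bar> \<le> 1 / real H"
    and parity: "e k p s mod 2 = e k p s' mod 2"
    if s: "s \<in> I1" "s' \<in> I1" "k \<in> J" "p \<in> S" for s s' k p
  proof -
    have "\<phi> s (k, p) = \<phi> s' (k, p)" using s by (simp add: I1_def)
    then have f: "\<lfloor>real H * (real (e k p s) / L s)\<rfloor> = \<lfloor>real H * (real (e k p s') / L s')\<rfloor>"
      and par: "e k p s mod 2 = e k p s' mod 2" using s by (auto simp: \<phi>_def)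
    show "e k p s mod 2 = e k p s' mod 2" by (rule par)
    have "\<bar>real H * (real (e k p s) / L s) - real H * (real (e k p s') / L s')\<bar> \<le> 1"
      using f by linarith
    then have "real H * \<bar>real (e k p s) / L s - real (e k p s') / L s'\<bar> \<le> 1"
      by (metis abs_mult abs_of_nat right_diff_distrib)
    then show "\<bar>real (e k p s) / L s - real (e k p s') / L s'\<bar> \<le> 1 / real H"
      using H0 by (simp add: field_simps)
  qed
  obtain s where s: "s \<in> I1" "s > B"
    using I1 infinite_nat_iff_unbounded by blast
  have sI0: "s \<in> I0" using s(1) by (simp add: I1_def)
  then have sI: "s \<in> I" "s \<ge> 2" by (auto simp: I0_def)
  \<comment> \<open>For \<open>n \<ge> n0\<close> the term \<open>16 * c * h * T\<close> below uses
    up less than half of \<open>n\<close>.\<close>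
  obtain n0 :: nat where n0: "real n0 > 32 * real c * (real h * T) + 1 + real B" using reals_Archimedean2 by blast
  obtain s' where s': "s' \<in> I1" "s' > (s ^ 8) ^ n0"
    using I1 infinite_nat_iff_unbounded by blast
  have s'I0: "s' \<in> I0" using s'(1) by (simp add: I1_def)
  then have s'I: "s' \<in> I" "s' \<ge> 2" by (auto simp: I0_def)
  have "s ^ 8 \<ge> 2" using sI(2) self_le_power[of s 8] by linarith
  \<comment> \<open>\<open>8 * n\<close> approximates \<open>L s' / L s\<close> from below with
    error at most 8.\<close>
  from ex_power_ivl1[OF this, of s'] s'I obtain n where n: "(s ^ 8) ^ n \<le> s'" "s' < (s ^ 8) ^ (n + 1)" by auto
  have "(s ^ 8) ^ n0 < (s ^ 8) ^ (n + 1)" using s'(2) n(2) by linarith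
  then have "n0 < n + 1" using \<open>s ^ 8 \<ge> 2\<close> by (subst (asm) power_strict_increasing_iff) auto
  then have "real n \<ge> real n0" by simp
  then have nB: "real n > 32 * real c * (real h * T) + 1 + real B" using n0 by linarith
  have "real h * T \<ge> 0" using T0 by simp
  then have "real c * (real h * T) \<ge> 0" by simp
  then have "real n \<ge> 1 + real B" using nB by (simp only: mult.assoc)
  then have n1: "real n \<ge> 1" "n \<ge> B" by linarith+
  have Ls: "L s > 0" "L s' > 0" using L_ge[OF sI0] L_ge[OF s'I0] by linarith+
  have "real ((s ^ 8) ^ n) \<le> real s'" using n(1) by (simp only: of_nat_le_iff)
  then have "ln (real s ^ (8 * n)) \<le> ln (real s')" using sI s'I by (subst ln_le_cancel_iff) (auto simp: power_mult)
  then have L1: "8 * real n * L s \<le> L s'" using sI by (simp add: ln_realpow L_def)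
  have "real s' \<le> real ((s ^ 8) ^ (n + 1))" using n(2) by (simp only: of_nat_le_iff)
  then have "ln (real s') \<le> ln (real s ^ (8 * (n + 1)))"
    using sI s'I unfolding power_mult by (subst ln_le_cancel_iff) auto
  also have "\<dots> = real (8 * (n + 1)) * L s" using sI unfolding L_def by (simp only: ln_realpow)
  finally have L2: "L s' \<le> 8 * (real n + 1) * L s" by (simp add: L_def algebra_simps)
  have small: "real h * (\<Sum>p\<in>S. real (u p) * ln (real p)) \<le> real n * L s"
    if u: "\<And>p. p \<in> S \<Longrightarrow> real (u p)
        \<le> \<bar>real (e k p s') - real (8 * n + 1) * real (e k p s)\<bar>"
      and k: "k \<in> J" for u k
  proof -
    \<comment> \<open>The first summand is the rounding error of the quotients scaled by
      \<open>L s'\<close>; the second comes from replacing \<open>L s' / L s\<close> by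
      \<open>8 * n + 1\<close>, an error of at most 8 times the bound \<open>2 * c * L s\<close> on
      the exponent.\<close>
    define \<beta> where "\<beta> = L s * (8 * (real n + 1) / real H + 16 * real c)"
    have up: "real (u p) \<le> \<beta>" if p: "p \<in> S" for p
    proof -
      have "real (e k p s') - L s' / L s * real (e k p s) = L s' * (real (e k p s') / L s' - real (e k p s) / L s)"
        using Ls by (simp add: right_diff_distrib)
      then have "\<bar>real (e k p s') - L s' / L s * real (e k p s)\<bar>
          = L s' * \<bar>real (e k p s') / L s' - real (e k p s) / L s\<bar>"
        using Ls by (simp add: abs_mult)
      also have "\<dots> \<le> L s' * (1 / real H)"
        using Ls close[OF s'(1) s(1) k p] by (intro mult_left_mono) auto
      also have "\<dots> \<le> 8 * (real n + 1) * L s * (1 / real H)"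
        using L2 H0 by (intro mult_right_mono) auto
      finally have 1: "\<bar>real (e k p s') - L s' / L s * real (e k p s)\<bar>
          \<le> 8 * (real n + 1) * L s * (1 / real H)" .
      have "8 * real n \<le> L s' / L s" "L s' / L s \<le> 8 * (real n + 1)"
        using L1 L2 Ls by (simp_all add: field_simps)
      then have "\<bar>L s' / L s - real (8 * n + 1)\<bar> \<le> 8" by simp
      then have "\<bar>L s' / L s - real (8 * n + 1)\<bar> * real (e k p s) \<le> 8 * (2 * real c * L s)"
        using e_le[OF sI0 k p] by (intro mult_mono) auto
      then have 2: "\<bar>L s' / L s * real (e k p s) - real (8 * n + 1) * real (e k p s)\<bar> \<le> 16 * real c * L s"
        by (simp only: left_diff_distrib[symmetric] abs_mult abs_of_nat)
      have "\<beta> = 8 * (real n + 1) * L s * (1 / real H) + 16 * real c * L s"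
        by (simp add: \<beta>_def algebra_simps add_divide_distrib)
      then show ?thesis using 1 2 u[OF p] by linarith
    qed
    have "(\<Sum>p\<in>S. real (u p) * ln (real p)) \<le> (\<Sum>p\<in>S. \<beta> * ln (real p))"
      by (intro sum_mono mult_right_mono up lnp)
    also have "\<dots> = \<beta> * T" by (simp add: T_def sum_distrib_left)
    finally have "real h * (\<Sum>p\<in>S. real (u p) * ln (real p)) \<le> real h * (\<beta> * T)"
      by (intro mult_left_mono) auto
    also have "\<dots> = L s * (8 * (real n + 1) * (real h * T / real H) + 16 * real c * (real h * T))"
      by (simp add: \<beta>_def algebra_simps add_divide_distrib)
    also have "\<dots> \<le> L s * real n"
    proof (intro mult_left_mono)
      have "real h * T / real H \<le> 1 / 32" using H H0 by (simp add: field_simps)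
      then have "8 * (real n + 1) * (real h * T / real H) \<le> 8 * (real n + 1) * (1 / 32)"
        by (intro mult_left_mono) auto
      then show "8 * (real n + 1) * (real h * T / real H) + 16 * real c * (real h * T) \<le> real n"
        using nB n1 by simp
    qed (use Ls in auto)
    finally show ?thesis by (simp add: mult.commute)
  qed
  have prod_small: "(\<Prod>p\<in>S. p ^ u p) > 0 \<and> (\<Prod>p\<in>S. p ^ u p) ^ h \<le> s ^ n"
    if u: "\<And>p. p \<in> S \<Longrightarrow> real (u p)
        \<le> \<bar>real (e k p s') - real (8 * n + 1) * real (e k p s)\<bar>"
      and k: "k \<in> J" for u k
  proof -
    have p0: "p > 0" if "p \<in> S" for p using that prime_gt_0_nat by (auto simp: S_def)
    have pos: "(\<Prod>p\<in>S. p ^ u p) > 0" using p0 by (intro prod_pos) auto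
    have "ln (real (\<Prod>p\<in>S. p ^ u p)) = (\<Sum>p\<in>S. ln (real p ^ u p))"
      using p0 fin_S by (simp add: ln_prod)
    also have "\<dots> = (\<Sum>p\<in>S. real (u p) * ln (real p))"
      using p0 by (simp only: ln_realpow)
    finally have "ln (real (\<Prod>p\<in>S. p ^ u p) ^ h) = real h * (\<Sum>p\<in>S. real (u p) * ln (real p))"
      using pos by (simp add: ln_realpow del: of_nat_prod)
    also have "\<dots> \<le> ln (real s ^ n)" using small[OF u k] sI by (simp add: ln_realpow L_def)
    finally have "real (\<Prod>p\<in>S. p ^ u p) ^ h \<le> real s ^ n"
      using pos sI by (subst (asm) ln_le_cancel_iff) (auto simp del: of_nat_prod)
    then have "real ((\<Prod>p\<in>S. p ^ u p) ^ h) \<le> real (s ^ n)" by (simp del: of_nat_prod)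
    then have "(\<Prod>p\<in>S. p ^ u p) ^ h \<le> s ^ n" by (simp only: of_nat_le_iff)
    with pos show ?thesis by simp
  qed
  show ?thesis
  proof (rule that)
    show "s \<in> I" "s' \<in> I" "B \<le> s" "B \<le> n" using sI s'I s n1 by auto
    show "s ^ (8 * n) \<le> s'" using n(1) by (simp add: power_mult)
    fix k assume k: "k \<in> J"
    define X where "X p = (8 * n + 1) * e k p s" for p
    \<comment> \<open>Truncated subtraction separates the two signs: \<open>a\<close> collects the
      excess of \<open>X p\<close>, \<open>b\<close> that of \<open>e k p s'\<close>. Halving is
      exact, because \<open>8 * n + 1\<close> is odd and the parities at \<open>s\<close> and
      \<open>s'\<close> agree.\<close>
    define a where "a = (\<Prod>p\<in>S. p ^ ((X p - e k p s') div 2))"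
    define b where "b = (\<Prod>p\<in>S. p ^ ((e k p s' - X p) div 2))"
    have half: "real ((i - j) div 2) \<le> \<bar>real j - real i\<bar>" for i j :: nat
      by linarith
    have X: "real (8 * n + 1) * real (e k p s) = real (X p)" for p
      by (simp only: X_def of_nat_mult)
    have "a > 0 \<and> a ^ h \<le> s ^ n" unfolding a_def
      by (rule prod_small[OF _ k]) (use half X in \<open>simp only:\<close>)
    moreover have "b > 0 \<and> b ^ h \<le> s ^ n" unfolding b_def
      by (rule prod_small[OF _ k]) (use half X in \<open>simp only: abs_minus_commute\<close>)
    moreover have "g k s' * a\<^sup>2 = g k s ^ (8 * n + 1) * b\<^sup>2"
    proof -
      have "g k s' = (\<Prod>p\<in>S. p ^ e k p s')"
        unfolding S_def e_def using s'I(1) k by (intro smooth_factorization g_pos g_smooth)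
      then have 1: "g k s' * a\<^sup>2 = (\<Prod>p\<in>S. p ^ (e k p s' + (X p - e k p s') div 2 * 2))"
        by (simp add: a_def prod_power_distrib[symmetric] prod.distrib power_add power_mult)
      have "g k s = (\<Prod>p\<in>S. p ^ e k p s)"
        unfolding S_def e_def using sI(1) k by (intro smooth_factorization g_pos g_smooth)
      then have "g k s ^ (8 * n + 1) = (\<Prod>p\<in>S. p ^ X p)"
        by (simp only: X_def prod_power_distrib power_mult[symmetric] mult.commute)
      then have 2: "g k s ^ (8 * n + 1) * b\<^sup>2 = (\<Prod>p\<in>S. p ^ (X p + (e k p s' - X p) div 2 * 2))"
        by (simp add: b_def prod_power_distrib[symmetric] prod.distrib power_add power_mult)
      have "e k p s' + (X p - e k p s') div 2 * 2 = X p + (e k p s' - X p) div 2 * 2" if p: "p \<in> S" for p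
      proof -
        have "X p = 2 * (4 * n * e k p s) + e k p s" by (simp add: X_def algebra_simps)
        then have "X p mod 2 = e k p s mod 2" by (simp only: mod_mult_self4)
        then have "X p mod 2 = e k p s' mod 2" using parity[OF s(1) s'(1) k p] by simp
        moreover have "j + (i - j) div 2 * 2 = i + (j - i) div 2 * 2" if "i mod 2 = j mod 2" for i j :: nat
          using that by presburger
        ultimately show ?thesis by blast
      qed
      then show ?thesis unfolding 1 2 by (intro prod.cong refl) simp
    qed
    ultimately show "\<exists>a b. a > 0 \<and> b > 0 \<and> a ^ h \<le> s ^ n \<and> b ^ h \<le> s ^ n \<and>
       g k s' * a\<^sup>2 = g k s ^ (8 * n + 1) * b\<^sup>2" by blast
  qed
qed

section \<open>Finiteness of the parameters\<close>

text \<open>\<open>4 * x\<close> equals \<open>q * d\<^sup>2\<close> up to lower-order terms. The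
  second bound follows from \<open>(q - 2) * (d\<^sup>2 - 2) \<ge> 0\<close> and
  \<open>(d - 1)\<^sup>2 \<ge> 0\<close>.\<close>

lemma parameter_bounds:
  fixes d q x :: nat
  assumes "d \<ge> 2" "q \<ge> 2" "2 * (2 * x + d) + q = 6 + q * d\<^sup>2"
  shows "4 * x \<le> q * d\<^sup>2" "q * d\<^sup>2 \<le> 8 * x"
proof -
  have "4 * x + 2 * d + q = 6 + r \<Longrightarrow> 4 * x \<le> r" for r using assms(1,2) by linarith
  then show "4 * x \<le> q * d\<^sup>2" using assms(3) by simp
  have "int d * int d \<ge> 2 * int d" using assms(1) by (intro mult_right_mono) auto
  then have "int d * int d \<ge> 2" using assms(1) by linarith
  then have "(int q - 2) * (int d * int d - 2) \<ge> 0" using assms(2) by (intro mult_nonneg_nonneg) auto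
  moreover have "(int d - 1) * (int d - 1) \<ge> 0" by simp
  moreover have "2 * (2 * int x + int d) + int q = 6 + int q * (int d * int d)"
    using arg_cong[OF assms(3), of int] by (simp add: power2_eq_square)
  ultimately have "int q * (int d * int d) \<le> 8 * int x" by (simp add: algebra_simps)
  then have "int (q * d\<^sup>2) \<le> int (8 * x)" by (simp add: power2_eq_square)
  then show "q * d\<^sup>2 \<le> 8 * x" by (simp only: of_nat_le_iff)
qed

lemma gbinomial_nonzero:
  fixes a :: real
  assumes "\<And>j. j < i \<Longrightarrow> a \<noteq> real j"
  shows "a gchoose i \<noteq> 0"
proof
  assume "a gchoose i = 0"
  then have "(\<Prod>j = 0..<i. a - real j) = 0" using gbinomial_mult_fact[of i a] by simp
  then show False using assms by auto
qed

lemma mult_power_le_ln: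
  assumes "a > 0" "b > 0" "real a ^ k \<le> real b ^ m"
  shows "real k * ln a \<le> real m * ln b"
proof -
  have "ln (real a ^ k) \<le> ln (real b ^ m)" using assms by (subst ln_le_cancel_iff) auto
  then show ?thesis by (simp only: ln_realpow)
qed

section \<open>The case \<open>d \<le> q ^ 8\<close>: approximation of an integral power\<close>

text \<open>Here the approximated function is \<open>(1 + z) ^ N\<close> at \<open>z = d / x\<close>. The gain comes from
  \<open>x * z\<^sup>2 \<le> 8 / q\<close>, which is at most a negative power of \<open>d\<close>.\<close>

lemma finite_large_alphabet:
  fixes I :: "nat set" and q x :: "nat \<Rightarrow> nat" and R :: nat
  assumes d2: "\<And>d. d \<in> I \<Longrightarrow> d \<ge> 2" and q2: "\<And>d. d \<in> I \<Longrightarrow> q d \<ge> 2"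
    and qd: "\<And>d. d \<in> I \<Longrightarrow> q d \<le> d\<^sup>2"
    and eq: "\<And>d. d \<in> I \<Longrightarrow> 2 * (2 * x d + d) + q d = 6 + q d * d\<^sup>2"
    and smooth: "\<And>d p. d \<in> I \<Longrightarrow> prime p \<Longrightarrow> p dvd 2 * q d * x d * (x d + d) \<Longrightarrow> p \<le> R"
    and large: "\<And>d. d \<in> I \<Longrightarrow> d \<le> q d ^ 8"
  shows "finite I"
proof (rule ccontr)
  assume inf: "infinite I"
  define g where "g k d = (if k then x d else x d + d)" for k :: bool and d
  have qdd: "q d * d\<^sup>2 \<le> d ^ 4" if "d \<in> I" for d
    using mult_right_mono[OF qd[OF that], of "d\<^sup>2"] by (simp add: power_add[symmetric])
  note b = parameter_bounds[OF d2 q2 eq]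
  have xpos: "x d > 0" if "d \<in> I" for d
  proof -
    have "q d * d\<^sup>2 > 0" using d2[OF that] q2[OF that] by simp
    then show ?thesis using b(2)[OF that that that] by linarith
  qed
  have g_le: "g k d \<le> d ^ 5" if d: "d \<in> I" for k d
  proof -
    have "4 * x d \<le> d ^ 4" using b(1)[OF d d d] qdd[OF d] by linarith
    moreover have "d \<le> d ^ 4" using d2[OF d] by (intro self_le_power) auto
    moreover have "2 * d ^ 4 \<le> d * d ^ 4" using d2[OF d] by (intro mult_right_mono) auto
    moreover have "d * d ^ 4 = d ^ 5" by (simp add: power_Suc[symmetric])
    ultimately show ?thesis by (auto simp: g_def)
  qed
  \<comment> \<open>With \<open>s \<ge> 2 ^ c\<close>, the power \<open>s ^ n\<close> outweighs all
    factors \<open>C ^ n\<close> that occur.\<close>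
  obtain c :: nat where c: "c \<ge> 1000" by blast
  obtain s s' n where s: "s \<in> I" "s' \<in> I" "s \<ge> 2 ^ c" "n \<ge> 2 ^ c" "s ^ (8 * n) \<le> s'"
    and rel: "\<And>k. k \<in> UNIV \<Longrightarrow> \<exists>a b. a > 0 \<and> b > 0 \<and> a ^ 64
        \<le> s ^ n \<and> b ^ 64 \<le> s ^ n \<and>
       g k s' * a\<^sup>2 = g k s ^ (8 * n + 1) * b\<^sup>2"
  proof (rule smooth_near_power[of I "UNIV :: bool set" g 5 R "2 ^ c" 64])
    show "g k s > 0" if "s \<in> I" for k s using xpos[OF that] by (simp add: g_def)
    show "g k s \<le> s ^ 5" if "s \<in> I" for k s by (rule g_le[OF that])
    show "p \<le> R" if "s \<in> I" "prime p" "p dvd g k s" for s k p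
      using that by (intro smooth[of s p]) (auto simp: g_def split: if_splits)
  qed (use inf in auto)
  define N where "N = 8 * n + 1"
  have n: "n \<ge> 1000" using s(4) less_exp[of c] c by linarith
  have s1000: "s \<ge> 1000" using s(3) less_exp[of c] c by linarith
  obtain a1 b1 where ab1: "a1 > 0" "b1 > 0" "a1 ^ 64 \<le> s ^ n" "b1 ^ 64 \<le> s ^ n" "x s' * a1\<^sup>2
      = x s ^ N * b1\<^sup>2"
    using rel[of True] by (auto simp: g_def N_def)
  obtain a2 b2 where ab2: "a2 > 0" "b2 > 0" "a2 ^ 64 \<le> s ^ n" "b2 ^ 64 \<le> s ^ n"
    "(x s' + s') * a2\<^sup>2 = (x s + s) ^ N * b2\<^sup>2"
    using rel[of False] by (auto simp: g_def N_def)
  define X X' where "X = x s" and "X' = x s'"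
  have X: "X > 0" "X' > 0" using xpos s by (auto simp: X_def X'_def)
  define z z' where "z = real s / X" and "z' = real s' / X'"
  \<comment> \<open>\<open>U / W\<close> equals \<open>(1 + z) ^ N / (1 + z')\<close>: a rational
    approximation of \<open>(1 + z) ^ N\<close> whose relative error is governed by the tiny
    \<open>z'\<close>.\<close>
  define U W where "U = (a2 * b1)\<^sup>2" and "W = (a1 * b2)\<^sup>2"
  have UW: "(1 + z') * U = (1 + z) ^ N * W"
  proof -
    have r1: "real X' * (real a1)\<^sup>2 = real X ^ N * (real b1)\<^sup>2"
      using arg_cong[OF ab1(5), of real] by (simp add: X_def X'_def)
    have r2: "(real X' + s') * (real a2)\<^sup>2 = (real X + s) ^ N * (real b2)\<^sup>2"
      using arg_cong[OF ab2(5), of real] by (simp add: X_def X'_def)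
    have z1: "1 + z = (real X + s) / X" "1 + z' = (real X' + s') / X'"
      using X by (simp_all add: z_def z'_def field_simps)
    have b1: "(real b1)\<^sup>2 = real X' * (real a1)\<^sup>2 / real X ^ N"
      using r1 X by (simp add: field_simps)
    have "(1 + z') * U = ((real X' + s') * (real a2)\<^sup>2) * (real b1)\<^sup>2 / X'"
      by (simp add: z1 U_def power_mult_distrib)
    also have "\<dots> = (real X + s) ^ N * (real b2)\<^sup>2 * (real a1)\<^sup>2 / real X ^ N"
      unfolding r2 b1 using X by simp
    also have "\<dots> = (1 + z) ^ N * W"
      by (simp add: z1 W_def power_mult_distrib power_divide)
    finally show ?thesis .
  qed
  have Xb: "q s * s\<^sup>2 \<le> 8 * X" "4 * X \<le> q s * s\<^sup>2" using b s by (auto simp: X_def)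
  have X'b: "q s' * s'\<^sup>2 \<le> 8 * X'" using b s by (auto simp: X'_def)
  have "8 * s \<le> X"
  proof -
    have "64 * s \<le> s * s" using s1000 by simp
    also have "\<dots> \<le> q s * s\<^sup>2" using q2[OF s(1)] by (simp add: power2_eq_square)
    finally show ?thesis using Xb by linarith
  qed
  define E :: nat where "E = 2 * N + 4 * n + 4 * n + 8"
  obtain P Q :: real where PQ: "\<bar>P\<bar> \<le> 2 ^ E" "\<bar>Q\<bar> \<le> 2 ^ E"
    "\<bar>Q * (1 + real_of_int (int s) / real_of_int (int X)) powr (real N) - P\<bar>
        \<le> 2 ^ E * \<bar>real_of_int (int s) / real_of_int (int X)\<bar> ^ (n + n + 1)"
    "(4 * int X) ^ (n + 1) * P \<in> \<int>" "(4 * int X) ^ n * Q \<in> \<int>" "Q * real U \<noteq> P * real W"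
    unfolding E_def
  proof (rule pade_approximation[of "real N" N n n "int X" "int s" "real U" "real W"])
    show "(real N + real n) gchoose Suc n \<noteq> 0"
      by (rule gbinomial_nonzero) (simp add: N_def)
    show "(real n - real N) gchoose n \<noteq> 0"
      by (rule gbinomial_nonzero) (simp add: N_def)
    show "\<bar>int s\<bar> * 8 \<le> int X" using \<open>8 * s \<le> X\<close> by simp
    show "real U \<noteq> 0" using ab1 ab2 by (simp add: U_def)
  qed (use X s1000 in auto)
  have z: "z > 0" "z' > 0" using X s1000 s(2) d2[OF s(2)] by (auto simp: z_def z'_def)
  have R: "\<bar>Q * (1 + z) ^ N - P\<bar> \<le> 2 ^ E * z ^ (2 * n + 1)"
    using PQ(3) z by (simp add: z_def powr_realpow mult_2)
  define \<Lambda> where "\<Lambda> = Q * U - P * W"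
  \<comment> \<open>Inserting \<open>Q * (1 + z) ^ N * W\<close> separates the Pade error from the
    error \<open>z'\<close> of the second solution.\<close>
  have "\<Lambda> = (Q * (1 + z) ^ N - P) * W - Q * z' * U"
    using arg_cong[OF UW, of "\<lambda>r. Q * r"] by (simp add: \<Lambda>_def algebra_simps)
  also have "\<bar>\<dots>\<bar> \<le> 2 ^ E * z ^ (2 * n + 1) * W + 2 ^ E * z' * U"
  proof -
    have "\<bar>(Q * (1 + z) ^ N - P) * W\<bar> \<le> 2 ^ E * z ^ (2 * n + 1) * W"
      unfolding abs_mult using R by (intro mult_mono) auto
    moreover have "\<bar>Q * z' * U\<bar> \<le> 2 ^ E * z' * U"
      unfolding abs_mult using PQ(2) z by (intro mult_mono) auto
    ultimately show ?thesis by linarith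
  qed
  finally have \<Lambda>: "\<bar>\<Lambda>\<bar> \<le> 2 ^ E * z ^ (2 * n + 1) * W + 2 ^ E * z' * U" .
  define M where "M = (4 * real X) ^ (n + 1)"
  have "M * \<Lambda> \<in> \<int>"
  proof -
    have "M * \<Lambda> = real (4 * X * U) * ((4 * int X) ^ n * Q) - ((4 * int X) ^ (n + 1) * P) * real W"
      by (simp add: M_def \<Lambda>_def algebra_simps)
    also have "\<dots> \<in> \<int>"
      by (rule Ints_diff[OF Ints_mult[OF Ints_of_nat PQ(5)] Ints_mult[OF PQ(4) Ints_of_nat]])
    finally show ?thesis .
  qed
  moreover have M: "M > 0" using X by (simp add: M_def)
  moreover have "\<Lambda> \<noteq> 0" using PQ(6) by (simp add: \<Lambda>_def)
  ultimately have "1 \<le> \<bar>M * \<Lambda>\<bar>" by (intro Ints_nonzero_abs_ge1) auto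
  also have "\<bar>M * \<Lambda>\<bar> \<le> M * (2 ^ E * z ^ (2 * n + 1) * W + 2 ^ E * z' * U)"
    unfolding abs_mult using M \<Lambda> by (intro mult_mono) auto
  also have "\<dots> = M * 2 ^ E * z ^ (2 * n + 1) * W + M * 2 ^ E * z' * U"
    by (simp add: algebra_simps)
  finally have one: "1 \<le> M * 2 ^ E * z ^ (2 * n + 1) * W + M * 2 ^ E * z' * U" .
  \<comment> \<open>Logarithms make the final estimates linear: \<open>y\<close> measures powers
    \<open>s ^ n\<close>, \<open>t\<close> measures constants \<open>2 ^ n\<close>, and
    \<open>y\<close> is at least 1000 times both \<open>t\<close> and \<open>l\<close>.\<close>
  define l where "l = ln (real s)"
  define y where "y = real n * l"
  define t where "t = real n * ln 2"
  have spos: "real s > 0" "real s' > 0" "real (q s) > 0" "real (q s') > 0" "real X > 0" "real X' > 0"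
    using s1000 d2[OF s(2)] q2[OF s(1)] q2[OF s(2)] X by linarith+
  have UWpos: "U > 0" "W > 0" "a1 > 0" "a2 > 0" "b1 > 0" "b2 > 0" using ab1 ab2 by (auto simp: U_def W_def)
  have "2 ^ c \<le> real s" using s(3) by (metis of_nat_le_iff of_nat_numeral of_nat_power)
  then have "ln (2 ^ c) \<le> l" unfolding l_def using spos by (subst ln_le_cancel_iff) auto
  then have "real c * ln 2 \<le> l" by (simp add: ln_realpow)
  moreover have "1000 * ln 2 \<le> real c * ln 2" using c by (intro mult_right_mono) auto
  ultimately have l1: "l \<ge> 1000 * ln 2" by linarith
  have y1: "y \<ge> 1000 * t" using mult_left_mono[OF l1, of "real n"] by (simp add: y_def t_def)
  have l0: "l \<ge> 0" using l1 ln2_ge_two_thirds by linarith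
  have y2: "y \<ge> 1000 * l" unfolding y_def using n l0 by (intro mult_right_mono) auto
  have t1: "t \<ge> 1000 * ln 2" unfolding t_def using n by (intro mult_right_mono) auto
  have lnab: "64 * ln a \<le> y" if "a > 0" "a ^ 64 \<le> s ^ n" for a :: nat
  proof -
    have "real (a ^ 64) \<le> real (s ^ n)" using that(2) by (simp only: of_nat_le_iff)
    then show ?thesis using mult_power_le_ln[of a s 64 n] that(1) spos by (simp add: y_def l_def)
  qed
  \<comment> \<open>\<open>U\<close> and \<open>W\<close> are products of four correction factors,
    each at most \<open>s ^ (n / 64)\<close>.\<close>
  have lnU: "16 * ln (real U) \<le> y" "16 * ln (real W) \<le> y"
    using lnab[of a1] lnab[of a2] lnab[of b1] lnab[of b2] ab1 ab2
    by (simp_all add: U_def W_def ln_realpow ln_mult)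
  have lnq: "8 * ln (real (q s)) \<ge> l"
  proof -
    have "real s ^ 1 \<le> real (q s) ^ 8" using large[OF s(1)] by (metis of_nat_le_iff of_nat_power power_one_right)
    then show ?thesis using mult_power_le_ln[of s "q s" 1 8] spos by (simp add: l_def)
  qed
  have lnq2: "ln (real (q s)) \<le> 2 * l"
  proof -
    have "real (q s) ^ 1 \<le> real s ^ 2" using qd[OF s(1)] by (metis of_nat_le_iff of_nat_power power_one_right)
    then show ?thesis using mult_power_le_ln[of "q s" s 1 2] spos by (simp add: l_def)
  qed
  have lns': "ln (real s') \<ge> 8 * y"
  proof -
    have "real s ^ (8 * n) \<le> real s' ^ 1" using s(5) by (metis of_nat_le_iff of_nat_power power_one_right)
    then show ?thesis using mult_power_le_ln[of s s' "8 * n" 1] spos by (simp add: l_def y_def)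
  qed
  have lnX: "2 * ln 2 + ln X \<le> ln (q s) + 2 * l" "ln (q s) + 2 * l \<le> 3 * ln 2 + ln X"
    "ln (q s') + 2 * ln s' \<le> 3 * ln 2 + ln X'"
  proof -
    have l4: "ln (4::real) = 2 * ln 2" "ln (8::real) = 3 * ln 2"
      using ln_realpow[of 2 2] ln_realpow[of 2 3] by simp_all
    have "ln (real (4 * X)) \<le> ln (real (q s * s\<^sup>2))"
        using Xb spos by (subst ln_le_cancel_iff) (auto simp del: of_nat_mult)
    then show "2 * ln 2 + ln X \<le> ln (q s) + 2 * l" using spos l4 by (simp add: ln_mult ln_realpow l_def)
    have "ln (real (q s * s\<^sup>2)) \<le> ln (real (8 * X))"
        using Xb spos by (subst ln_le_cancel_iff) (auto simp del: of_nat_mult)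
    then show "ln (q s) + 2 * l \<le> 3 * ln 2 + ln X" using spos l4 by (simp add: ln_mult ln_realpow l_def)
    have "ln (real (q s' * s'\<^sup>2)) \<le> ln (real (8 * X'))"
        using X'b spos by (subst ln_le_cancel_iff) (auto simp del: of_nat_mult)
    then show "ln (q s') + 2 * ln s' \<le> 3 * ln 2 + ln X'" using spos l4 by (simp add: ln_mult ln_realpow)
  qed
  have lnM: "ln M = (real n + 1) * (2 * ln 2 + ln X)"
    using spos ln_realpow[of 2 2] by (simp add: M_def ln_mult ln_realpow algebra_simps)
  have lnE: "ln (2 ^ E :: real) \<le> 25 * t"
  proof -
    have "real E \<le> 25 * real n" using n by (simp add: E_def N_def)
    then show ?thesis by (simp add: ln_realpow t_def mult_right_mono)
  qed
  have lnz: "ln z = l - ln X" "ln z' = ln s' - ln X'"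
    using spos by (simp_all add: z_def z'_def ln_div l_def)
  \<comment> \<open>The decisive factor is \<open>(4 * X) ^ n * z ^ (2 * n)\<close>, at most
    \<open>(32 / q s) ^ n\<close> and so at most \<open>32 ^ n * s powr (-n/8)\<close>;
    \<open>W\<close> costs only \<open>s powr (n/16)\<close>.\<close>
  have "M * 2 ^ E * z ^ (2 * n + 1) * W < 1 / 2"
  proof -
    have "ln (M * 2 ^ E * z ^ (2 * n + 1) * W) = ln M + ln (2 ^ E) + real (2 * n + 1) * ln z + ln W"
      using M z UWpos by (simp add: ln_mult ln_realpow algebra_simps)
    also have "\<dots> = ln (2 ^ E) + (real n) * (2 * ln 2 + 2 * l - ln X) + (2 * ln 2 + l) + ln W"
      unfolding lnM lnz by (simp add: algebra_simps)
    also have "real n * (2 * ln 2 + 2 * l - ln X) \<le> real n * (5 * ln 2 - l / 8)"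
      using lnX(2) lnq by (intro mult_left_mono) auto
    also have "\<dots> = 5 * t - y / 8" by (simp add: t_def y_def algebra_simps)
    finally have "ln (M * 2 ^ E * z ^ (2 * n + 1) * W) < - ln 2"
      using lnE lnU t1 y1 y2 l1 ln2_ge_two_thirds by linarith
    then have "ln (M * 2 ^ E * z ^ (2 * n + 1) * W) < ln (1 / 2)" by (simp add: ln_div)
    then show ?thesis using M z UWpos by (subst (asm) ln_less_cancel_iff) auto
  qed
  \<comment> \<open>\<open>M\<close> is at most \<open>s ^ (4 * (n + 1))\<close>, while
    \<open>z' \<le> 8 / (q s' * s')\<close> is at most \<open>8 / s ^ (8 * n)\<close>.\<close>
  moreover have "M * 2 ^ E * z' * U < 1 / 2"
  proof -
    have "ln (M * 2 ^ E * z' * U) = ln M + ln (2 ^ E) + ln z' + ln U"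
      using M z UWpos by (simp add: ln_mult ln_realpow algebra_simps)
    also have "ln M \<le> (real n + 1) * (4 * l)"
      unfolding lnM using lnX(1) lnq2 by (intro mult_left_mono) auto
    also have "\<dots> = 4 * y + 4 * l" by (simp add: y_def algebra_simps)
    finally have "ln (M * 2 ^ E * z' * U) \<le> 4 * y + 4 * l + ln (2 ^ E) + ln z' + ln U" by simp
    moreover have "ln (q s') \<ge> 0" using q2[OF s(2)] by simp
    ultimately have "ln (M * 2 ^ E * z' * U) < - ln 2"
      using lnX(3) lns' lnz lnE lnU t1 y1 y2 l1 ln2_ge_two_thirds by linarith
    then have "ln (M * 2 ^ E * z' * U) < ln (1 / 2)" by (simp add: ln_div)
    then show ?thesis using M z UWpos by (subst (asm) ln_less_cancel_iff) auto
  qed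
  ultimately show False using one by linarith
qed

section \<open>The case \<open>q ^ 8 \<le> d\<close>: approximation of a square root\<close>

text \<open>\<open>D\<close> is the amount by which \<open>4 * q * x\<close> falls short of the
  square of \<open>q * d - 1\<close>. It must not vanish, as \<open>D / w\<close> is the argument of
  the Pade approximant; \<open>D = 0\<close> would force \<open>q\<close> to divide 1.\<close>

lemma discriminant_bounds:
  fixes q :: nat
  assumes "q \<ge> 2"
  defines "D \<equiv> (int q)\<^sup>2 - 6 * int q + 1"
  shows "D \<noteq> 0" "\<bar>D\<bar> \<le> 2 * (int q)\<^sup>2"
proof -
  have "D = 0 \<Longrightarrow> int q * (6 - int q) = 1" by (simp add: D_def power2_eq_square algebra_simps)
  then have "D = 0 \<Longrightarrow> int q dvd 1" by (metis dvd_triv_left)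
  then show "D \<noteq> 0" using assms by auto
  have "int q * int q \<ge> 2 * int q" using assms by (intro mult_right_mono) auto
  moreover have "\<bar>p - 6 * int q + 1\<bar> \<le> 2 * p" if "p \<ge> 2 * int q" for p using that assms(1) by linarith
  ultimately show "\<bar>D\<bar> \<le> 2 * (int q)\<^sup>2" by (simp add: D_def power2_eq_square)
qed

text \<open>Here the approximated function is \<open>sqrt (1 + D / w)\<close>, where \<open>w = 4 * q * x
    = Y\<^sup>2 - D\<close> with
  \<open>Y = q * d - 1\<close> and \<open>D
      = q\<^sup>2 - 6 * q + 1\<close>. The denominator has degree \<open>6 * n\<close> and the numerator degree
  \<open>2 * n\<close>, so that the factor \<open>w ^ (4 * n)\<close> missing in the numerator cancels against the power
  of \<open>w\<close> in the second solution.\<close>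

lemma finite_small_alphabet:
  fixes I :: "nat set" and q x :: "nat \<Rightarrow> nat" and R :: nat
  assumes d2: "\<And>d. d \<in> I \<Longrightarrow> d \<ge> 2" and q2: "\<And>d. d \<in> I \<Longrightarrow> q d \<ge> 2"
    and qd: "\<And>d. d \<in> I \<Longrightarrow> q d \<le> d\<^sup>2"
    and eq: "\<And>d. d \<in> I \<Longrightarrow> 2 * (2 * x d + d) + q d = 6 + q d * d\<^sup>2"
    and smooth: "\<And>d p. d \<in> I \<Longrightarrow> prime p \<Longrightarrow> p dvd 2 * q d * x d * (x d + d) \<Longrightarrow> p \<le> R"
    and small: "\<And>d. d \<in> I \<Longrightarrow> q d ^ 8 \<le> d"
  shows "finite I"
proof (rule ccontr)
  assume inf: "infinite I"
  define w where "w d = 4 * q d * x d" for d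
  note b = parameter_bounds[OF d2 q2 eq]
  have w_upper: "w d \<le> (q d)\<^sup>2 * d\<^sup>2" if "d \<in> I" for d
    using mult_left_mono[OF b(1)[OF that that that], of "q d"] by (simp add: w_def power2_eq_square mult_ac)
  have w_lower: "(q d)\<^sup>2 * d\<^sup>2 \<le> 2 * w d" if "d \<in> I" for d
    using mult_left_mono[OF b(2)[OF that that that], of "q d"] by (simp add: w_def power2_eq_square mult_ac)
  have w_pos: "w d > 0" if "d \<in> I" for d
  proof -
    have "(q d)\<^sup>2 * d\<^sup>2 > 0" using d2[OF that] q2[OF that] by simp
    then show ?thesis using w_lower[OF that] by linarith
  qed
  obtain c :: nat where c: "c \<ge> 1000" by blast
  obtain s s' n where s: "s \<in> I" "s' \<in> I" "s \<ge> 2 ^ c" "n \<ge> 2 ^ c" "s ^ (8 * n) \<le> s'"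
    and rel: "\<And>k. k \<in> UNIV \<Longrightarrow> \<exists>a b. a > 0 \<and> b > 0 \<and> a ^ 64
        \<le> s ^ n \<and> b ^ 64 \<le> s ^ n \<and>
       w s' * a\<^sup>2 = w s ^ (8 * n + 1) * b\<^sup>2"
  proof (rule smooth_near_power[of I "UNIV :: unit set" "\<lambda>_. w" 6 R "2 ^ c" 64])
    show "w s > 0" if "s \<in> I" for s by (rule w_pos[OF that])
    show "w s \<le> s ^ 6" if "s \<in> I" for s
    proof -
      have "(q s)\<^sup>2 * s\<^sup>2 \<le> (s\<^sup>2)\<^sup>2 * s\<^sup>2"
          using qd[OF that] by (intro mult_right_mono power_mono) auto
      also have "\<dots> = s ^ 6" by (simp add: power_add[symmetric] power_mult[symmetric])
      finally show ?thesis using w_upper[OF that] by linarith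
    qed
    show "p \<le> R" if "s \<in> I" "prime p" "p dvd w s" for s p
    proof (rule smooth[OF that(1,2)])
      have "w s = 2 * 2 * q s * x s" by (simp add: w_def)
      then have "p dvd 2 \<or> p dvd q s \<or> p dvd x s" using that by (metis prime_dvd_mult_iff)
      then show "p dvd 2 * q s * x s * (x s + s)" by auto
    qed
  qed (use inf in auto)
  obtain a b where ab: "a > 0" "b > 0" "a ^ 64 \<le> s ^ n" "b ^ 64 \<le> s ^ n" "w s' * a\<^sup>2
      = w s ^ (8 * n + 1) * b\<^sup>2"
    using rel by blast
  have n: "n \<ge> 1000" using s(4) less_exp[of c] c by linarith
  have s1000: "s \<ge> 1000" using s(3) less_exp[of c] c by linarith
  define D where "D d = (int (q d))\<^sup>2 - 6 * int (q d) + 1" for d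
  define Y where "Y d = int (q d) * int d - 1" for d
  have wYD: "int (w d) + D d = (Y d)\<^sup>2" if "d \<in> I" for d
  proof -
    have "2 * (2 * int (x d) + int d) + int (q d) = 6 + int (q d) * (int d)\<^sup>2"
      using arg_cong[OF eq[OF that], of int] by simp
    then have e: "4 * int (x d) = 6 + int (q d) * (int d)\<^sup>2 - int (q d) - 2 * int d" by algebra
    have "int (w d) = int (q d) * (4 * int (x d))" by (simp add: w_def)
    then show ?thesis unfolding e by (simp add: D_def Y_def power2_eq_square algebra_simps)
  qed
  have D0: "D s \<noteq> 0" using discriminant_bounds(1)[OF q2[OF s(1)]] by (simp add: D_def)
  have D_le: "\<bar>D d\<bar> \<le> 2 * (int (q d))\<^sup>2" if "d \<in> I" for d
    using discriminant_bounds(2)[OF q2[OF that]] by (simp add: D_def)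
  have Y_ge: "2 * Y d \<ge> int (q d) * int d" if "d \<in> I" for d
  proof -
    have "int (q d) * int d \<ge> 2 * 1" using q2[OF that] d2[OF that] by (intro mult_mono) auto
    moreover have "p \<le> 2 * (p - 1)" if "p \<ge> 2 * 1" for p :: int using that by simp
    ultimately show ?thesis unfolding Y_def by blast
  qed
  have Ypos: "Y d > 0" if "d \<in> I" for d
  proof -
    have "int (q d) * int d > 0" using q2[OF that] d2[OF that] by simp
    then show ?thesis using Y_ge[OF that] by linarith
  qed
  have D8: "\<bar>D s\<bar> * 8 \<le> int (w s)"
  proof -
    have "32 \<le> s" using s1000 by simp
    also have "s \<le> s\<^sup>2" using s1000 by (intro self_le_power) auto
    finally have "32 \<le> s\<^sup>2" .
    then have "(q s)\<^sup>2 * 32 \<le> (q s)\<^sup>2 * s\<^sup>2" by (rule mult_left_mono) simp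
    then have "(q s)\<^sup>2 * 16 \<le> w s" using w_lower[OF s(1)] by linarith
    then have "int ((q s)\<^sup>2 * 16) \<le> int (w s)" by (simp only: of_nat_le_iff)
    then show ?thesis using D_le[OF s(1)] by simp
  qed
  define E :: nat where "E = 2 * 1 + 4 * (6 * n) + 4 * (2 * n) + 8"
  \<comment> \<open>\<open>U / W\<close> is close to \<open>sqrt (1 + D s / w s)\<close>, that is,
    to \<open>Y s / sqrt (w s)\<close>: the relation between \<open>w s\<close> and
    \<open>w s'\<close> gives \<open>sqrt (w s') * a = sqrt (w s) * w s ^ (4 * n) * b\<close>, and
    \<open>Y s'\<close> is close to \<open>sqrt (w s')\<close>.\<close>
  define U where "U = Y s * int b * int (w s) ^ (4 * n)"
  define W where "W = int a * Y s'"
  have nothalf: "1 / 2 + real i \<noteq> real j" for i j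
  proof
    assume "1 / 2 + real i = real j"
    then have "real (1 + 2 * i) = real (2 * j)" by simp
    then have "1 + 2 * i = 2 * j" by (simp only: of_nat_eq_iff)
    then show False by presburger
  qed
  then have nothalf': "real i - 1 / 2 \<noteq> real j" for i j
    by (metis add.commute diff_add_cancel)
  obtain P Q :: real where PQ: "\<bar>P\<bar> \<le> 2 ^ E" "\<bar>Q\<bar> \<le> 2 ^ E"
    "\<bar>Q * (1 + real_of_int (D s) / real_of_int (int (w s))) powr (1 / 2) - P\<bar>
        \<le> 2 ^ E * \<bar>real_of_int (D s) / real_of_int (int (w s))\<bar> ^ (6 * n + 2 * n + 1)"
    "(4 * int (w s)) ^ (2 * n + 1) * P \<in> \<int>" "(4 * int (w s)) ^ (6 * n) * Q \<in> \<int>" "Q * real_of_int U \<noteq> P * real_of_int W"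
    unfolding E_def
  proof (rule pade_approximation[of "1 / 2" 1 "6 * n" "2 * n" "int (w s)" "D s" "real_of_int U" "real_of_int W"])
    show "(1 / 2 + real (6 * n)) gchoose Suc (2 * n) \<noteq> 0"
      by (rule gbinomial_nonzero) (rule nothalf)
    show "(real (2 * n) - 1 / 2) gchoose (6 * n) \<noteq> 0"
      by (rule gbinomial_nonzero) (rule nothalf')
    show "real_of_int U \<noteq> 0" using ab Ypos[OF s(1)] w_pos[OF s(1)] by (simp add: U_def)
  qed (use w_pos[OF s(1)] D0 D8 in auto)
  define v v' where "v = real (w s)" and "v' = real (w s')"
  have v: "v > 0" "v' > 0" using w_pos s by (auto simp: v_def v'_def)
  define \<tau> where "\<tau> = \<bar>real_of_int (D s) / v\<bar>"
  have \<tau>: "\<tau> > 0" using D0 v by (simp add: \<tau>_def)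
  have root: "(1 + real_of_int (D s) / real_of_int (int (w s))) powr (1 / 2) = Y s / sqrt v"
  proof -
    have "v + D s = (real_of_int (Y s))\<^sup>2"
      using arg_cong[OF wYD[OF s(1)], of real_of_int] by (simp add: v_def)
    then have "1 + D s / v = (Y s / sqrt v)\<^sup>2" using v by (simp add: power_divide field_simps)
    moreover have "Y s / sqrt v > 0" using Ypos[OF s(1)] v by simp
    ultimately have "(1 + D s / v) powr (1 / 2) = Y s / sqrt v"
      using v Ypos[OF s(1)] by (simp add: powr_half_sqrt)
    then show ?thesis by (simp add: v_def)
  qed
  define r where "r = Q * (Y s / sqrt v) - P"
  have r: "\<bar>r\<bar> \<le> 2 ^ E * \<tau> ^ (8 * n + 1)"
    using PQ(3) unfolding root r_def \<tau>_def v_def by simp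
  have sq: "sqrt v' * a = sqrt v * v ^ (4 * n) * b"
  proof (rule power2_eq_imp_eq)
    have "v' * (real a)\<^sup>2 = v ^ (8 * n + 1) * (real b)\<^sup>2"
      using arg_cong[OF ab(5), of real] by (simp add: v_def v'_def)
    moreover have "v ^ (8 * n + 1) = v * (v ^ (4 * n))\<^sup>2" by (simp add: power_mult[symmetric])
    ultimately show "(sqrt v' * a)\<^sup>2 = (sqrt v * v ^ (4 * n) * b)\<^sup>2"
      using v by (simp add: power_mult_distrib)
  qed (use v in auto)
  define \<Lambda> where "\<Lambda> = Q * U - P * W"
  have "Q * Y s = (P + r) * sqrt v" using v by (simp add: r_def field_simps)
  then have "Q * U = (P + r) * (sqrt v * v ^ (4 * n) * b)" by (simp add: U_def v_def)
  \<comment> \<open>The first summand carries the distance of \<open>sqrt v'\<close> from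
    \<open>Y s'\<close>, the second the Pade error \<open>r\<close>.\<close>
  then have "\<Lambda> = P * a * (sqrt v' - Y s') + r * (sqrt v * v ^ (4 * n) * b)"
    unfolding sq[symmetric] by (simp add: \<Lambda>_def W_def algebra_simps)
  also have "\<bar>\<dots>\<bar> \<le> 2 ^ E * a * (4 * q s' / s') + 2 ^ E * \<tau> ^ (8 * n + 1) * (sqrt v * v ^ (4 * n) * b)"
  proof -
    have pos: "real (q s') > 0" "real s' > 0" "real_of_int (Y s') > 0"
      using q2[OF s(2)] d2[OF s(2)] Ypos[OF s(2)] by auto
    have "real_of_int (int (q s') * int s') \<le> real_of_int (2 * Y s')" using Y_ge[OF s(2)] by (simp only: of_int_le_iff)
    then have "q s' * real s' \<le> 2 * real_of_int (Y s')" by simp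
    moreover have "0 \<le> sqrt v'" using v by simp
    ultimately have y: "q s' * real s' / 2 \<le> sqrt v' + Y s'" by linarith
    have "v' + D s' = (real_of_int (Y s'))\<^sup>2"
      using arg_cong[OF wYD[OF s(2)], of real_of_int] by (simp add: v'_def)
    \<comment> \<open>Conjugation: \<open>D s'\<close> is of order at most
      \<open>(q s')\<^sup>2\<close> and the conjugate factor at least of order
      \<open>q s' * s'\<close>, so the distance is at most of order
      \<open>q s' / s'\<close>.\<close>
    then have "(sqrt v' - Y s') * (sqrt v' + Y s') = - D s'"
      using v by (simp add: algebra_simps power2_eq_square)
    then have "\<bar>sqrt v' - Y s'\<bar> * (sqrt v' + Y s') = \<bar>real_of_int (D s')\<bar>"
      using v pos by (metis abs_minus_cancel abs_mult abs_of_pos add_pos_pos real_sqrt_gt_zero of_int_minus)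
    moreover have "\<bar>sqrt v' - Y s'\<bar> * (q s' * real s' / 2) \<le> \<bar>sqrt v' - Y s'\<bar> * (sqrt v' + Y s')"
      using y by (intro mult_left_mono) auto
    moreover have "\<bar>real_of_int (D s')\<bar> \<le> 2 * (real (q s'))\<^sup>2"
    proof -
      have "real_of_int \<bar>D s'\<bar> \<le> real_of_int (2 * (int (q s'))\<^sup>2)"
          using D_le[OF s(2)] by (simp only: of_int_le_iff)
      then show ?thesis by simp
    qed
    ultimately have "\<bar>sqrt v' - Y s'\<bar> * (q s' * real s' / 2) \<le> 2 * (real (q s'))\<^sup>2" by linarith
    then have near: "\<bar>sqrt v' - Y s'\<bar> \<le> 4 * q s' / s'"
      using pos by (simp add: field_simps power2_eq_square)
    have "\<bar>P * a * (sqrt v' - Y s')\<bar> \<le> 2 ^ E * a * (4 * q s' / s')"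
      unfolding abs_mult using PQ(1) near by (intro mult_mono) (auto intro: mult_right_mono)
    moreover have "\<bar>r * (sqrt v * v ^ (4 * n) * b)\<bar>
        \<le> 2 ^ E * \<tau> ^ (8 * n + 1) * (sqrt v * v ^ (4 * n) * b)"
      unfolding abs_mult[of r] using r v by (intro mult_mono) auto
    ultimately show ?thesis by linarith
  qed
  finally have \<Lambda>: "\<bar>\<Lambda>\<bar>
      \<le> 2 ^ E * a * (4 * q s' / s') + 2 ^ E * \<tau> ^ (8 * n + 1) * (sqrt v * v ^ (4 * n) * b)" .
  \<comment> \<open>\<open>Q\<close> needs \<open>(4 * w s) ^ (6 * n)\<close>, of which
    \<open>U\<close> supplies \<open>w s ^ (4 * n)\<close>; the separate power of 4 replaces the
    missing fours.\<close>
  define M where "M = 4 ^ (4 * n) * (4 * v) ^ (2 * n + 1)"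
  have "M * \<Lambda> \<in> \<int>"
  proof -
    have "6 * n = 2 * n + 4 * n" by simp
    then have "(4 * v) ^ (6 * n) = (4 * v) ^ (2 * n) * (4 ^ (4 * n) * v ^ (4 * n))"
      by (simp only: power_add power_mult_distrib[of 4 v "4 * n"])
    then have v6: "4 ^ (4 * n) * (4 * v) ^ (2 * n + 1) * v ^ (4 * n) = 4 * v * (4 * v) ^ (6 * n)"
      by (simp only: power_add power_one_right mult_ac)
    have "M * \<Lambda> = of_int (4 * int (w s) * Y s * int b) * ((4 * int (w s)) ^ (6 * n) * Q)
       - (4 * int (w s)) ^ (2 * n + 1) * P * of_int (4 ^ (4 * n) * W)"
    proof -
      have "M * \<Lambda> = 4 ^ (4 * n) * (4 * v) ^ (2 * n + 1) * v ^ (4 * n) * (Q * Y s * b) - 4 ^ (4 * n) * (4 * v) ^ (2 * n + 1) * P * W"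
        by (simp add: M_def \<Lambda>_def U_def v_def algebra_simps)
      then show ?thesis unfolding v6 by (simp add: v_def mult_ac)
    qed
    also have "\<dots> \<in> \<int>"
      by (rule Ints_diff[OF Ints_mult[OF Ints_of_int PQ(5)] Ints_mult[OF PQ(4) Ints_of_int]])
    finally show ?thesis .
  qed
  moreover have M: "M > 0" using v by (simp add: M_def)
  moreover have "\<Lambda> \<noteq> 0" using PQ(6) by (simp add: \<Lambda>_def)
  ultimately have "1 \<le> \<bar>M * \<Lambda>\<bar>" by (intro Ints_nonzero_abs_ge1) auto
  also have "\<bar>M * \<Lambda>\<bar> \<le> M * (2 ^ E * a * (4 * q s' / s') + 2 ^ E * \<tau> ^ (8 * n + 1) * (sqrt v * v ^ (4 * n) * b))"
    unfolding abs_mult using M \<Lambda> by (intro mult_mono) auto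
  also have "\<dots> = M * 2 ^ E * a * (4 * q s' / s') + M * 2 ^ E * \<tau> ^ (8 * n + 1) * (sqrt v * v ^ (4 * n) * b)"
    by (simp add: distrib_left mult.assoc)
  finally have one: "1 \<le> M * 2 ^ E * a * (4 * q s' / s') + M * 2 ^ E * \<tau> ^ (8 * n + 1) * (sqrt v * v ^ (4 * n) * b)" .
  define l where "l = ln (real s)"
  define y where "y = real n * l"
  define t where "t = real n * ln 2"
  have spos: "real s > 0" "real s' > 0" "real (q s) > 0" "real (q s') > 0"
    using s1000 d2[OF s(2)] q2[OF s(1)] q2[OF s(2)] by linarith+
  have "2 ^ c \<le> real s" using s(3) by (metis of_nat_le_iff of_nat_numeral of_nat_power)
  then have "ln (2 ^ c) \<le> l" unfolding l_def using spos by (subst ln_le_cancel_iff) auto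
  then have "real c * ln 2 \<le> l" by (simp add: ln_realpow)
  moreover have "1000 * ln 2 \<le> real c * ln 2" using c by (intro mult_right_mono) auto
  ultimately have l1: "l \<ge> 1000 * ln 2" by linarith
  have y1: "y \<ge> 1000 * t" using mult_left_mono[OF l1, of "real n"] by (simp add: y_def t_def)
  have l0: "l \<ge> 0" using l1 ln2_ge_two_thirds by linarith
  have y2: "y \<ge> 1000 * l" unfolding y_def using n l0 by (intro mult_right_mono) auto
  have t1: "t \<ge> 1000 * ln 2" unfolding t_def using n by (intro mult_right_mono) auto
  have lnab: "64 * ln a \<le> y" if "a > 0" "a ^ 64 \<le> s ^ n" for a :: nat
  proof -
    have "real (a ^ 64) \<le> real (s ^ n)" using that(2) by (simp only: of_nat_le_iff)
    then show ?thesis using mult_power_le_ln[of a s 64 n] that(1) spos by (simp add: y_def l_def)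
  qed
  have lnq: "8 * ln (real (q d)) \<le> ln (real d)" if "d \<in> I" for d
  proof -
    have "real (q d) ^ 8 \<le> real d ^ 1" using small[OF that] by (metis of_nat_le_iff of_nat_power power_one_right)
    then show ?thesis using mult_power_le_ln[of "q d" d 8 1] q2[OF that] d2[OF that] by simp
  qed
  have lns': "ln (real s') \<ge> 8 * y"
  proof -
    have "real s ^ (8 * n) \<le> real s' ^ 1" using s(5) by (metis of_nat_le_iff of_nat_power power_one_right)
    then show ?thesis using mult_power_le_ln[of s s' "8 * n" 1] spos by (simp add: l_def y_def)
  qed
  have l4: "ln (4::real) = 2 * ln 2" using ln_realpow[of 2 2] by simp
  have lnv: "ln v \<le> 2 * ln (q s) + 2 * l" "2 * ln (q s) + 2 * l \<le> ln 2 + ln v"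
  proof -
    have "ln v \<le> ln (real ((q s)\<^sup>2 * s\<^sup>2))"
      unfolding v_def using w_upper[OF s(1)] w_pos[OF s(1)] spos by (subst ln_le_cancel_iff) (auto simp del: of_nat_mult)
    then show "ln v \<le> 2 * ln (q s) + 2 * l" using spos by (simp add: ln_mult ln_realpow l_def)
    have "ln (real ((q s)\<^sup>2 * s\<^sup>2)) \<le> ln (real (2 * w s))"
      using w_lower[OF s(1)] w_pos[OF s(1)] spos by (subst ln_le_cancel_iff) (auto simp del: of_nat_mult)
    then show "2 * ln (q s) + 2 * l \<le> ln 2 + ln v"
        using spos w_pos[OF s(1)] by (simp add: ln_mult ln_realpow l_def v_def)
  qed
  have ln\<tau>: "ln \<tau> \<le> ln 2 + 2 * ln (q s) - ln v"
  proof -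
    have "real_of_int \<bar>D s\<bar> \<le> real_of_int (2 * (int (q s))\<^sup>2)"
        using D_le[OF s(1)] by (simp only: of_int_le_iff)
    then have "\<tau> \<le> 2 * (real (q s))\<^sup>2 / v" using v by (simp add: \<tau>_def divide_right_mono)
    then have "ln \<tau> \<le> ln (2 * (real (q s))\<^sup>2 / v)" using \<tau> v spos by (subst ln_le_cancel_iff) auto
    then show ?thesis using v spos by (simp add: ln_mult ln_div ln_realpow)
  qed
  have lnM: "ln M = 8 * t + (2 * real n + 1) * (2 * ln 2 + ln v)"
    using v by (simp add: M_def ln_mult ln_realpow l4 t_def algebra_simps)
  have lnE: "ln (2 ^ E :: real) \<le> 33 * t"
  proof -
    have "real E \<le> 33 * real n" using n by (simp add: E_def)
    then show ?thesis by (simp add: ln_realpow t_def mult_right_mono)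
  qed
  \<comment> \<open>Up to constants \<open>C ^ n\<close> and bounded powers, the main part is
    \<open>q s ^ (16 * n) / v ^ (2 * n)\<close>, about \<open>q s ^ (12 * n) / s ^ (4 * n)\<close>,
    hence at most \<open>s powr (-5*n/2)\<close> as \<open>q s ^ 8 \<le> s\<close>.\<close>
  have "M * 2 ^ E * \<tau> ^ (8 * n + 1) * (sqrt v * v ^ (4 * n) * b) < 1 / 2"
  proof -
    have "ln (M * 2 ^ E * \<tau> ^ (8 * n + 1) * (sqrt v * v ^ (4 * n) * b)) =
       ln M + ln (2 ^ E) + (8 * real n + 1) * ln \<tau> + (1 / 2 + 4 * real n) * ln v + ln b"
      using M \<tau> v ab by (simp add: ln_mult ln_realpow ln_sqrt algebra_simps)
    also have "(8 * real n + 1) * ln \<tau> \<le> (8 * real n + 1) * (ln 2 + 2 * ln (q s) - ln v)"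
      by (intro mult_left_mono ln\<tau>) auto
    finally have "ln (M * 2 ^ E * \<tau> ^ (8 * n + 1) * (sqrt v * v ^ (4 * n) * b)) \<le>
       ln (2 ^ E) + ln b + 20 * t + 3 * ln 2 + (16 * real n + 2) * ln (q s) - (2 * real n - 1 / 2) * ln v"
      unfolding lnM t_def by (simp add: algebra_simps)
    moreover have "(2 * real n - 1 / 2) * (2 * ln (q s) + 2 * l - ln 2) \<le> (2 * real n - 1 / 2) * ln v"
      using lnv n by (intro mult_left_mono) auto
    moreover have "(2 * real n - 1 / 2) * (2 * ln (q s) + 2 * l - ln 2)
        = 4 * (real n * ln (q s)) - ln (q s) + 4 * y - l - 2 * t + ln 2 / 2"
      by (simp add: y_def t_def algebra_simps)
    moreover have "(16 * real n + 2) * ln (q s) = 16 * (real n * ln (q s)) + 2 * ln (q s)" by (simp add: algebra_simps)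
    moreover have "8 * (real n * ln (q s)) \<le> y"
      using mult_left_mono[OF lnq[OF s(1)], of "real n"] by (simp add: y_def l_def)
    ultimately have "ln (M * 2 ^ E * \<tau> ^ (8 * n + 1) * (sqrt v * v ^ (4 * n) * b)) < - ln 2"
      using lnE lnab[OF ab(2,4)] lnq[OF s(1), folded l_def] t1 y1 y2 l1 ln2_ge_two_thirds by linarith
    then have "ln (M * 2 ^ E * \<tau> ^ (8 * n + 1) * (sqrt v * v ^ (4 * n) * b)) < ln (1 / 2)" by (simp add: ln_div)
    then show ?thesis using M \<tau> v ab by (subst (asm) ln_less_cancel_iff) auto
  qed
  \<comment> \<open>\<open>v \<le> s powr (9/4)\<close> puts \<open>M\<close> at about
    \<open>s powr (9*n/2)\<close>, against \<open>q s' / s' \<le> s' powr (-7/8)\<close>, which is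
    at most \<open>s powr (-7*n)\<close>.\<close>
  moreover have "M * 2 ^ E * a * (4 * q s' / s') < 1 / 2"
  proof -
    have "ln (M * 2 ^ E * a * (4 * q s' / s')) = ln M + ln (2 ^ E) + ln a + 2 * ln 2 + ln (q s') - ln s'"
      using M ab spos by (simp add: ln_mult ln_div l4)
    also have "ln M \<le> 8 * t + (2 * real n + 1) * (2 * ln 2 + 9 / 4 * l)"
      unfolding lnM using lnv(1) lnq[OF s(1), folded l_def] by (intro add_left_mono mult_left_mono) auto
    also have "8 * t + (2 * real n + 1) * (2 * ln 2 + 9 / 4 * l) = 12 * t + 9 / 2 * y + 2 * ln 2 + 9 / 4 * l"
      by (simp add: t_def y_def algebra_simps)
    finally have "ln (M * 2 ^ E * a * (4 * q s' / s')) < - ln 2"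
      using lnE lnab[OF ab(1,3)] lnq[OF s(2)] lns' t1 y1 y2 l1 ln2_ge_two_thirds by linarith
    then have "ln (M * 2 ^ E * a * (4 * q s' / s')) < ln (1 / 2)" by (simp add: ln_div)
    then show ?thesis using M ab spos by (subst (asm) ln_less_cancel_iff) auto
  qed
  ultimately show False using one by linarith
qed

text \<open>The two cases bound only \<open>d\<close>, so a single choice of \<open>q\<close> and
  \<open>x\<close> for each \<open>d\<close> is enough for them; afterwards
  \<open>q \<le> d\<^sup>2\<close> leaves finitely many \<open>q\<close>.\<close>

lemma finite_parameters:
  fixes R :: nat
  shows "finite {(q, d). 2 \<le> d \<and> 2 \<le> q \<and> q
      \<le> d\<^sup>2 \<and> (\<exists>x. 2 * (2 * x + d) + q = 6 + q * d\<^sup>2 \<and>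
    (\<forall>p. prime p \<longrightarrow> p dvd 2 * q * x * (x + d) \<longrightarrow> p \<le> R))}" (is "finite ?Z")
proof -
  define good where "good q d x \<longleftrightarrow> 2 \<le> d \<and> 2 \<le> q \<and> q
      \<le> d\<^sup>2 \<and> 2 * (2 * x + d) + q = 6 + q * d\<^sup>2 \<and>
    (\<forall>p. prime p \<longrightarrow> p dvd 2 * q * x * (x + d) \<longrightarrow> p \<le> R)" for q d x :: nat
  define A where "A = {d. \<exists>q x. good q d x \<and> d \<le> q ^ 8}"
  define A' where "A' = {d. \<exists>q x. good q d x \<and> q ^ 8 \<le> d}"
  have "\<forall>d\<in>A. \<exists>u. good (fst u) d (snd u) \<and> d \<le> fst u ^ 8" by (auto simp: A_def)
  from bchoice[OF this] obtain u where u: "\<And>d. d \<in> A \<Longrightarrow> good (fst (u d)) d (snd (u d)) \<and> d \<le> fst (u d) ^ 8"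
    by blast
  have "finite A"
    by (rule finite_large_alphabet[of A "\<lambda>d. fst (u d)" "\<lambda>d. snd (u d)" R]; use u in \<open>unfold good_def, blast\<close>)
  have "\<forall>d\<in>A'. \<exists>u. good (fst u) d (snd u) \<and> fst u ^ 8 \<le> d" by (auto simp: A'_def)
  from bchoice[OF this] obtain u' where u': "\<And>d. d \<in> A' \<Longrightarrow> good (fst (u' d)) d (snd (u' d)) \<and> fst (u' d) ^ 8 \<le> d"
    by blast
  have "finite A'"
    by (rule finite_small_alphabet[of A' "\<lambda>d. fst (u' d)" "\<lambda>d. snd (u' d)" R]; use u' in \<open>unfold good_def, blast\<close>)
  have "?Z \<subseteq> (\<Union>d\<in>A \<union> A'. {..d\<^sup>2} \<times> {d})"
  proof clarify
    fix q d x :: nat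
    assume "2 \<le> d" "2 \<le> q" "q \<le> d\<^sup>2" "2 * (2 * x + d) + q = 6 + q * d\<^sup>2"
      "\<forall>p. prime p \<longrightarrow> p dvd 2 * q * x * (x + d) \<longrightarrow> p \<le> R"
    then have "good q d x" by (simp add: good_def)
    then have "d \<in> A \<union> A'" using linear[of d "q ^ 8"] unfolding A_def A'_def by blast
    then show "(q, d) \<in> (\<Union>d\<in>A \<union> A'. {..d\<^sup>2} \<times> {d})"
        using \<open>q \<le> d\<^sup>2\<close> by blast
  qed
  moreover have "finite (\<Union>d\<in>A \<union> A'. {..d\<^sup>2} \<times> {d})"
    using \<open>finite A\<close> \<open>finite A'\<close> by simp
  ultimately show ?thesis by (rule finite_subset)
qed

theorem theorem3:
  fixes P0 :: nat
  assumes "P0 > 0"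
  shows "finite {(q :: nat, n :: nat). q \<ge> 2 \<and> n > 2 \<and> greatest_prime_factor q \<le> P0 \<and>
           (\<exists>C. perfect_code {1..q} n 2 C)}"
proof -
  let ?Z = "{(q, d). 2 \<le> d \<and> 2 \<le> q \<and> q \<le> d\<^sup>2 \<and> (\<exists>x. 2 * (2 * x + d) + q
      = 6 + q * d\<^sup>2 \<and>
    (\<forall>p. prime p \<longrightarrow> p dvd 2 * q * x * (x + d) \<longrightarrow> p \<le> max 2 P0))}"
  \<comment> \<open>The discriminant identity
    \<open>q\<^sup>2 * d\<^sup>2 = q\<^sup>2 + 4 * (q - 1) * (n - 2)\<close> solved for
    \<open>n\<close>.\<close>
  define f :: "nat \<times> nat \<Rightarrow> nat \<times> nat"
    where "f = (\<lambda>(q, d). (q, (q\<^sup>2 * d\<^sup>2 - q\<^sup>2) div (4 * (q - 1)) + 2))"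
  have "{(q, n). q \<ge> 2 \<and> n > 2 \<and> greatest_prime_factor q \<le> P0 \<and>
           (\<exists>C. perfect_code {1..q} n 2 C)} \<subseteq> f ` ?Z"
  proof clarify
    fix q n :: nat and C
    assume q: "2 \<le> q" and n: "2 < n" and gpf: "greatest_prime_factor q \<le> P0"
      and C: "perfect_code {1..q} n 2 C"
    interpret perfect_2_code "{1..q}" n C by unfold_locales (use q n C in auto)
    have card: "card {1..q} = q" by simp
    obtain x y d where xyd: "d \<ge> 2" "x > 0" "y = x + d" "2 * (x + y) + q = 6 + q * d\<^sup>2" "q \<le> d\<^sup>2"
      "q\<^sup>2 * d\<^sup>2 = q\<^sup>2 + 4 * (q - 1) * (n - 2)" "\<And>p. prime p \<Longrightarrow> p dvd x * y \<Longrightarrow> p dvd 2 * q"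
      by (rule parameters[unfolded card]) (rule that)
    have "p \<le> max 2 P0" if p: "prime p" "p dvd 2 * q * x * (x + d)" for p
    proof -
      have "p dvd (2 * q) * (x * y)" using p(2) by (simp only: xyd(3) mult.assoc)
      then have "p dvd 2 * q" using prime_dvd_multD[OF p(1)] xyd(7)[OF p(1)] by blast
      then have "p dvd 2 \<or> p dvd q" using p(1) by (simp add: prime_dvd_mult_iff)
      then show ?thesis
      proof
        assume "p dvd 2"
        then show ?thesis by (auto dest: dvd_imp_le)
      next
        assume "p dvd q"
        then have "p \<in> prime_factors q" using p(1) q by (simp add: in_prime_factors_iff)
        then have "p \<le> greatest_prime_factor q" unfolding greatest_prime_factor_def by simp
        then show ?thesis using gpf by simp
      qed
    qed
    moreover have "2 * (2 * x + d) + q = 6 + q * d\<^sup>2" using xyd(3,4) by simp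
    ultimately have Z: "(q, d) \<in> ?Z" using xyd(1,5) q by blast
    have f: "f (q, d) = (q, n)"
    proof -
      have "q\<^sup>2 * d\<^sup>2 - q\<^sup>2 = 4 * (q - 1) * (n - 2)" using xyd(6) by simp
      moreover have "4 * (q - 1) * (n - 2) div (4 * (q - 1)) = n - 2"
        using q by (intro nonzero_mult_div_cancel_left) simp
      ultimately show ?thesis using n unfolding f_def by simp
    qed
    show "(q, n) \<in> f ` ?Z" using imageI[OF Z, of f] unfolding f .
  qed
  moreover have "finite (f ` ?Z)" by (intro finite_imageI finite_parameters)
  ultimately show ?thesis by (rule finite_subset)
qed

end
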